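(* Let $(\mathfrak{g},\Omega,\vartheta)$ be a nilpotent lcs Lie algebra with $\vartheta\neq0$, with characteristic vector $V$, and let $\mathcal{Z}(\mathfrak{g})$ be the center of $\mathfrak{g}$. Then either $\mathcal{Z}(\mathfrak{g})=\langle V\rangle$, or $\mathcal{Z}(\mathfrak{g})=\langle U,V\rangle$ for a transversal vector $U$ and $\mathfrak{g}\cong\mathfrak{h}\oplus\mathbb{R}$ as Lie algebras, where $\mathfrak{h}$ is a contact Lie algebra.
   Context: Lie algebras are real and finite-dimensional; $d$ is the Chevalley–Eilenberg differential. An lcs Lie algebra $(\mathfrak{g},\Omega,\vartheta)$ is a Lie algebra of dimension $2n\ge4$ with $\Omega\in\Lambda^2\mathfrak{g}^*$, $\vartheta\in\mathfrak{g}^*$, $\Omega^n\ne0$, $d\vartheta=0$, $d\Omega=\vartheta\wedge\Omega$. The characteristic vector $V$ is defined by $\imath_V\Omega=\vartheta$. A transversal vector is a $U\in\mathfrak{g}_\Omega=\{X\in\mathfrak{g}\mid L_X\Omega=0\}$ with $\vartheta(U)=1$, where $L_X=\imath_Xd+d\imath_X$. A contact Lie algebra is a Lie algebra $\mathfrak{h}$ of dimension $2n-1$ with $\eta\in\mathfrak{h}^*$ such that $\eta\wedge(d\eta)^{n-1}\neq0$. *)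

theory Defs
  imports "HOL-Analysis.Product_Vector" "HOL-Combinatorics.Permutations"
begin

section \<open>Finite-dimensional real Lie algebras\<close>

text \<open>
  A Lie algebra is a finite-dimensional linear subspace \<open>\<gg>\<close> of some ambient real vector space,
  with a bracket that is only constrained on \<open>\<gg>\<close>. The ambient space plays no role.
\<close>

locale lie_algebra =
  fixes \<gg> :: "'a::real_vector set" and br :: "'a \<Rightarrow> 'a \<Rightarrow> 'a"
  assumes subspace: "subspace \<gg>"
    and finite_dim: "\<exists>B. finite B \<and> span B = \<gg>"
    and br_closed: "x \<in> \<gg> \<Longrightarrow> y \<in> \<gg> \<Longrightarrow> br x y \<in> \<gg>"
    and br_add_left: "x \<in> \<gg> \<Longrightarrow> y \<in> \<gg> \<Longrightarrow> z \<in> \<gg> \<Longrightarrow> br (x + y) z = br x z + br y z"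
    and br_scale_left: "x \<in> \<gg> \<Longrightarrow> y \<in> \<gg> \<Longrightarrow> br (c *\<^sub>R x) y = c *\<^sub>R br x y"
    and br_add_right: "x \<in> \<gg> \<Longrightarrow> y \<in> \<gg> \<Longrightarrow> z \<in> \<gg> \<Longrightarrow> br x (y + z) = br x y + br x z"
    and br_scale_right: "x \<in> \<gg> \<Longrightarrow> y \<in> \<gg> \<Longrightarrow> br x (c *\<^sub>R y) = c *\<^sub>R br x y"
    and br_self: "x \<in> \<gg> \<Longrightarrow> br x x = 0"
    and jacobi: "x \<in> \<gg> \<Longrightarrow> y \<in> \<gg> \<Longrightarrow> z \<in> \<gg> \<Longrightarrow>
      br x (br y z) + br y (br z x) + br z (br x y) = 0"

definition lie_center :: "'a::real_vector set \<Rightarrow> ('a \<Rightarrow> 'a \<Rightarrow> 'a) \<Rightarrow> 'a set" where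
  "lie_center \<gg> br = {x \<in> \<gg>. \<forall>y\<in>\<gg>. br x y = 0}"

primrec lower_central :: "'a::real_vector set \<Rightarrow> ('a \<Rightarrow> 'a \<Rightarrow> 'a) \<Rightarrow> nat \<Rightarrow> 'a set" where
  "lower_central \<gg> br 0 = \<gg>"
| "lower_central \<gg> br (Suc k) = span {br x y | x y. x \<in> \<gg> \<and> y \<in> lower_central \<gg> br k}"

definition lie_nilpotent :: "'a::real_vector set \<Rightarrow> ('a \<Rightarrow> 'a \<Rightarrow> 'a) \<Rightarrow> bool" where
  "lie_nilpotent \<gg> br \<longleftrightarrow> (\<exists>k. lower_central \<gg> br k = {0})"

definition lie_isomorphic ::
  "'a::real_vector set \<Rightarrow> ('a \<Rightarrow> 'a \<Rightarrow> 'a) \<Rightarrow> 'b::real_vector set \<Rightarrow> ('b \<Rightarrow> 'b \<Rightarrow> 'b) \<Rightarrow> bool" where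
  "lie_isomorphic \<gg> br \<hh> br' \<longleftrightarrow> (\<exists>f. bij_betw f \<gg> \<hh>
     \<and> (\<forall>x\<in>\<gg>. \<forall>y\<in>\<gg>. f (x + y) = f x + f y)
     \<and> (\<forall>c. \<forall>x\<in>\<gg>. f (c *\<^sub>R x) = c *\<^sub>R f x)
     \<and> (\<forall>x\<in>\<gg>. \<forall>y\<in>\<gg>. f (br x y) = br' (f x) (f y)))"

text \<open>The bracket of a direct sum; its carrier is the product of the carriers.\<close>

definition sum_bracket ::
  "('a \<Rightarrow> 'a \<Rightarrow> 'a) \<Rightarrow> ('b \<Rightarrow> 'b \<Rightarrow> 'b) \<Rightarrow> 'a \<times> 'b \<Rightarrow> 'a \<times> 'b \<Rightarrow> 'a \<times> 'b" where
  "sum_bracket br br' x y = (br (fst x) (fst y), br' (snd x) (snd y))"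


section \<open>Exterior forms and the Chevalley--Eilenberg differential\<close>

text \<open>
  A \<open>k\<close>-form on \<open>\<gg>\<close> is represented by a function on lists, of which only the values on lists of
  length \<open>k\<close> with entries in \<open>\<gg>\<close> matter. Equality of \<open>k\<close>-forms is therefore \<open>form_eq \<gg> k\<close>,
  not equality of functions.
\<close>

definition alt_form :: "'a::real_vector set \<Rightarrow> nat \<Rightarrow> ('a list \<Rightarrow> real) \<Rightarrow> bool" where
  "alt_form \<gg> k \<alpha> \<longleftrightarrow> (\<forall>xs. length xs = k \<and> set xs \<subseteq> \<gg> \<longrightarrow>
     (\<forall>i<k. \<forall>x\<in>\<gg>. \<forall>y\<in>\<gg>. \<alpha> (xs[i := x + y]) = \<alpha> (xs[i := x]) + \<alpha> (xs[i := y])) \<and>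
     (\<forall>i<k. \<forall>x\<in>\<gg>. \<forall>c. \<alpha> (xs[i := c *\<^sub>R x]) = c * \<alpha> (xs[i := x])) \<and>
     (\<forall>i j. i < j \<and> j < k \<and> xs ! i = xs ! j \<longrightarrow> \<alpha> xs = 0))"

definition form_eq :: "'a set \<Rightarrow> nat \<Rightarrow> ('a list \<Rightarrow> real) \<Rightarrow> ('a list \<Rightarrow> real) \<Rightarrow> bool" where
  "form_eq \<gg> k \<alpha> \<beta> \<longleftrightarrow> (\<forall>xs. length xs = k \<and> set xs \<subseteq> \<gg> \<longrightarrow> \<alpha> xs = \<beta> xs)"

definition zero_form :: "'a list \<Rightarrow> real" where
  "zero_form xs = 0"

text \<open>
  The wedge product of a \<open>p\<close>-form and a \<open>q\<close>-form, normalised so that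
  \<open>(\<alpha> \<and> \<beta>)(x, y) = \<alpha>(x) \<beta>(y) - \<alpha>(y) \<beta>(x)\<close> for 1-forms.
\<close>

definition wedge ::
  "nat \<Rightarrow> nat \<Rightarrow> ('a list \<Rightarrow> real) \<Rightarrow> ('a list \<Rightarrow> real) \<Rightarrow> 'a list \<Rightarrow> real" where
  "wedge p q \<alpha> \<beta> xs = (\<Sum>\<sigma> | \<sigma> permutes {..<p + q}. of_int (sign \<sigma>)
      * \<alpha> (map (\<lambda>i. xs ! \<sigma> i) [0..<p]) * \<beta> (map (\<lambda>i. xs ! \<sigma> i) [p..<p + q]))
    / (fact p * fact q)"

text \<open>The \<open>m\<close>-th exterior power of a \<open>p\<close>-form, an \<open>m * p\<close>-form.\<close>

primrec wedge_power :: "nat \<Rightarrow> ('a list \<Rightarrow> real) \<Rightarrow> nat \<Rightarrow> 'a list \<Rightarrow> real" where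
  "wedge_power p \<alpha> 0 = (\<lambda>xs. 1)"
| "wedge_power p \<alpha> (Suc m) = wedge p (m * p) \<alpha> (wedge_power p \<alpha> m)"

text \<open>
  \<open>(d\<alpha>)(x\<^sub>0, \<dots>, x\<^sub>k) = (\<Sum>i<j. (-1)\<^sup>i\<^sup>+\<^sup>j \<alpha>([x\<^sub>i, x\<^sub>j], x\<^sub>0, \<dots>, x\<^sub>k))\<close> with \<open>x\<^sub>i\<close> and \<open>x\<^sub>j\<close> omitted
  from the tail; in particular \<open>(d\<alpha>)(x, y) = - \<alpha>([x, y])\<close> for a 1-form.
\<close>

definition ce_diff :: "('a \<Rightarrow> 'a \<Rightarrow> 'a) \<Rightarrow> ('a list \<Rightarrow> real) \<Rightarrow> 'a list \<Rightarrow> real" where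
  "ce_diff br \<alpha> xs = (\<Sum>j<length xs. \<Sum>i<j.
     (-1) ^ (i + j) * \<alpha> (br (xs ! i) (xs ! j) # nths xs (- {i, j})))"

definition interior_product :: "'a \<Rightarrow> ('a list \<Rightarrow> real) \<Rightarrow> 'a list \<Rightarrow> real" where
  "interior_product X \<alpha> xs = \<alpha> (X # xs)"

definition lie_derivative ::
  "('a \<Rightarrow> 'a \<Rightarrow> 'a) \<Rightarrow> 'a \<Rightarrow> ('a list \<Rightarrow> real) \<Rightarrow> 'a list \<Rightarrow> real" where
  "lie_derivative br X \<alpha> xs =
     interior_product X (ce_diff br \<alpha>) xs + ce_diff br (interior_product X \<alpha>) xs"


section \<open>Locally conformally symplectic and contact Lie algebras\<close>

locale lcs_lie_algebra = lie_algebra \<gg> br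
  for \<gg> :: "'a::real_vector set" and br :: "'a \<Rightarrow> 'a \<Rightarrow> 'a" +
  fixes n :: nat and \<Omega> \<theta> :: "'a list \<Rightarrow> real"
  assumes dim_eq: "dim \<gg> = 2 * n"
    and dim_ge: "2 * n \<ge> 4"
    and Omega_form: "alt_form \<gg> 2 \<Omega>"
    and theta_form: "alt_form \<gg> 1 \<theta>"
    and nondegenerate: "\<not> form_eq \<gg> (2 * n) (wedge_power 2 \<Omega> n) zero_form"
    and theta_closed: "form_eq \<gg> 2 (ce_diff br \<theta>) zero_form"
    and d_Omega: "form_eq \<gg> 3 (ce_diff br \<Omega>) (wedge 1 2 \<theta> \<Omega>)"

definition characteristic_vector ::
  "'a set \<Rightarrow> ('a list \<Rightarrow> real) \<Rightarrow> ('a list \<Rightarrow> real) \<Rightarrow> 'a \<Rightarrow> bool" where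
  "characteristic_vector \<gg> \<Omega> \<theta> V \<longleftrightarrow> V \<in> \<gg> \<and> form_eq \<gg> 1 (interior_product V \<Omega>) \<theta>"

definition lcs_automorphisms ::
  "'a set \<Rightarrow> ('a \<Rightarrow> 'a \<Rightarrow> 'a) \<Rightarrow> ('a list \<Rightarrow> real) \<Rightarrow> 'a set" where
  "lcs_automorphisms \<gg> br \<Omega> = {X \<in> \<gg>. form_eq \<gg> 2 (lie_derivative br X \<Omega>) zero_form}"

definition transversal_vector ::
  "'a set \<Rightarrow> ('a \<Rightarrow> 'a \<Rightarrow> 'a) \<Rightarrow> ('a list \<Rightarrow> real) \<Rightarrow> ('a list \<Rightarrow> real) \<Rightarrow> 'a \<Rightarrow> bool" where
  "transversal_vector \<gg> br \<Omega> \<theta> U \<longleftrightarrow> U \<in> lcs_automorphisms \<gg> br \<Omega> \<and> \<theta> [U] = 1"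

text \<open>Writing the dimension as \<open>dim \<hh> + 1 = 2 * m\<close> forces \<open>m \<ge> 1\<close>.\<close>

locale contact_lie_algebra = lie_algebra \<hh> br
  for \<hh> :: "'a::real_vector set" and br :: "'a \<Rightarrow> 'a \<Rightarrow> 'a" +
  fixes m :: nat and \<eta> :: "'a list \<Rightarrow> real"
  assumes dim_eq: "dim \<hh> + 1 = 2 * m"
    and eta_form: "alt_form \<hh> 1 \<eta>"
    and contact: "\<not> form_eq \<hh> (2 * m - 1)
      (wedge 1 (2 * (m - 1)) \<eta> (wedge_power 2 (ce_diff br \<eta>) (m - 1))) zero_form"

end

theory Submission
  imports Defs
begin

text \<open>
  The ideal \<open>ker \<theta>\<close> contains \<open>V \<noteq> 0\<close>, so by nilpotency it meets the center. For central
  \<open>x \<in> ker \<theta>\<close>, contracting \<open>d\<Omega> = \<theta> \<and> \<Omega>\<close> with \<open>x\<close> and with some \<open>U\<close> such that \<open>\<theta>(U) = 1\<close> gives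
  \<open>\<Omega>(x, [U, z]) = - \<Omega>(x, z)\<close> for all \<open>z \<in> ker \<theta>\<close>; since \<open>ad U\<close> is nilpotent, \<open>\<Omega>(x, \<cdot>)\<close> is a
  multiple of \<open>\<theta>\<close>, i.e. \<open>x\<close> is a multiple of \<open>V\<close>. Hence \<open>V\<close> spans the intersection of the center
  with \<open>ker \<theta>\<close>, and the center is \<open>\<langle>V\<rangle>\<close> or \<open>\<langle>U, V\<rangle>\<close> with \<open>U\<close> central and \<open>\<theta>(U) = 1\<close>. In the
  latter case \<open>\<gg> = ker \<theta> \<oplus> \<langle>U\<rangle>\<close>, and \<open>\<eta> = - \<iota>\<^sub>U \<Omega>\<close> satisfies \<open>d\<eta> = \<Omega>\<close> on \<open>ker \<theta>\<close>, where
  \<open>n \<eta> \<and> \<Omega>\<^sup>n\<^sup>-\<^sup>1 = - \<iota>\<^sub>U \<Omega>\<^sup>n \<noteq> 0\<close>.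
\<close>

section \<open>Alternation and the wedge product\<close>

text \<open>Unnormalised, without division by \<open>fact k\<close>, so that wedge products differ
  from alternations of tensor products only by explicit constants.\<close>

definition alternation :: "nat \<Rightarrow> ('a list \<Rightarrow> real) \<Rightarrow> 'a list \<Rightarrow> real" where
  "alternation k f xs =
     (\<Sum>\<sigma> | \<sigma> permutes {..<k}. of_int (sign \<sigma>) * f (permute_list \<sigma> xs))"

text \<open>Permuting the whole argument list and cutting it after \<open>p\<close> entries replaces
  the permuted indices in \<open>wedge\<close>, so facts about alternations apply to wedge
  products.\<close>

lemma wedge_eq_alternation:
  assumes "length xs = p + q"
  shows "wedge p q \<alpha> \<beta> xs =
    alternation (p + q) (\<lambda>ys. \<alpha> (take p ys) * \<beta> (drop p ys)) xs / (fact p * fact q)"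
  using assms
  by (simp add: wedge_def alternation_def permute_list_def take_map drop_map mult.assoc
      del: upt_Suc)

lemma alternation_cong:
  assumes "length xs = k"
    and "\<And>ys. length ys = k \<Longrightarrow> set ys = set xs \<Longrightarrow> f ys = g ys"
  shows "alternation k f xs = alternation k g xs"
  unfolding alternation_def
  by (intro sum.cong refl arg_cong2[where f = "(*)"] assms(2))
     (use assms(1) in \<open>auto simp: set_permute_list\<close>)

lemma sign_compose_permutes:
  "finite S \<Longrightarrow> \<sigma> permutes S \<Longrightarrow> \<tau> permutes S \<Longrightarrow> sign (\<sigma> \<circ> \<tau>) = sign \<sigma> * sign \<tau>"
  by (meson permutation_permutes sign_compose)

text \<open>Replacing \<open>\<sigma>\<close> by \<open>\<tau> \<circ> \<sigma>\<close> only
  reorders the sum, and the sign of \<open>\<tau>\<close> comes out as a factor whose square is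
  1.\<close>

lemma alternation_permute_list:
  assumes \<tau>: "\<tau> permutes {..<k}" and len: "length xs = k"
  shows "alternation k f (permute_list \<tau> xs) = of_int (sign \<tau>) * alternation k f xs"
proof -
  have "alternation k f xs = (\<Sum>\<sigma> | \<sigma> permutes {..<k}.
      of_int (sign (\<tau> \<circ> \<sigma>)) * f (permute_list (\<tau> \<circ> \<sigma>) xs))"
    unfolding alternation_def by (rule setum_permutations_compose_left[OF \<tau>])
  also have "\<dots> = (\<Sum>\<sigma> | \<sigma> permutes {..<k}.
      of_int (sign \<tau>) * (of_int (sign \<sigma>) * f (permute_list \<sigma> (permute_list \<tau> xs))))"
    using \<tau> len sign_compose_permutes[OF finite_lessThan \<tau>]
    by (intro sum.cong refl) (simp add: permute_list_compose)
  also have "\<dots> = of_int (sign \<tau>) * alternation k f (permute_list \<tau> xs)"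
    by (simp add: alternation_def sum_distrib_left)
  finally have "of_int (sign \<tau>) * alternation k f xs
      = (of_int (sign \<tau> * sign \<tau>) :: real) * alternation k f (permute_list \<tau> xs)"
    by (simp del: sign_idempotent)
  then show ?thesis by simp
qed

lemma permute_list_transpose_same:
  assumes "i < length xs" "j < length xs" "xs ! i = xs ! j"
  shows "permute_list (transpose i j) xs = xs"
  by (rule nth_equalityI) (use assms in \<open>auto simp: permute_list_def transpose_def\<close>)

text \<open>Exchanging the equal entries leaves the list unchanged but reverses the sign of the
  alternation, which is therefore its own negative.\<close>

lemma alternation_repeated:
  assumes "length xs = k" "i < j" "j < k" "xs ! i = xs ! j"
  shows "alternation k f xs = 0"
proof -
  have "transpose i j permutes {..<k}"
    by (rule permutes_swap_id) (use assms in auto)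
  from alternation_permute_list[OF this assms(1), of f]
  show ?thesis
    using assms by (simp add: permute_list_transpose_same sign_swap_id)
qed

text \<open>Entry \<open>l\<close> of the permuted list is entry \<open>\<sigma> l\<close> of the
  original, so position \<open>i\<close> travels to \<open>inv \<sigma> i\<close>.\<close>

lemma permute_list_update:
  assumes "\<sigma> permutes {..<length xs}" "i < length xs"
  shows "permute_list \<sigma> (xs[i := x]) = (permute_list \<sigma> xs)[inv \<sigma> i := x]"
proof (rule nth_equalityI)
  fix l assume "l < length (permute_list \<sigma> (xs[i := x]))"
  then have l: "l < length xs" by simp
  have "\<sigma> l < length xs" using permutes_in_image[OF assms(1)] l by auto
  moreover have "inv \<sigma> i = l \<longleftrightarrow> \<sigma> l = i" using permutes_inv_eq[OF assms(1)] by auto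
  ultimately show "permute_list \<sigma> (xs[i := x]) ! l = (permute_list \<sigma> xs)[inv \<sigma> i := x] ! l"
    using l assms by (auto simp: permute_list_def nth_list_update)
qed simp

section \<open>Multilinear and alternating forms\<close>

definition multilinear_form :: "'a::real_vector set \<Rightarrow> nat \<Rightarrow> ('a list \<Rightarrow> real) \<Rightarrow> bool" where
  "multilinear_form \<gg> k \<alpha> \<longleftrightarrow> (\<forall>xs. length xs = k \<and> set xs \<subseteq> \<gg> \<longrightarrow>
     (\<forall>i<k. \<forall>x\<in>\<gg>. \<forall>y\<in>\<gg>. \<alpha> (xs[i := x + y]) = \<alpha> (xs[i := x]) + \<alpha> (xs[i := y])) \<and>
     (\<forall>i<k. \<forall>x\<in>\<gg>. \<forall>c. \<alpha> (xs[i := c *\<^sub>R x]) = c * \<alpha> (xs[i := x])))"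

lemma alt_form_multilinear: "alt_form \<gg> k \<alpha> \<Longrightarrow> multilinear_form \<gg> k \<alpha>"
  unfolding alt_form_def multilinear_form_def by blast

lemma alt_form_repeated:
  "alt_form \<gg> k \<alpha> \<Longrightarrow> length xs = k \<Longrightarrow> set xs \<subseteq> \<gg> \<Longrightarrow> i < j \<Longrightarrow> j < k \<Longrightarrow> xs ! i = xs ! j \<Longrightarrow> \<alpha> xs = 0"
  unfolding alt_form_def by blast

lemma multilinear_form_add:
  "multilinear_form \<gg> k \<alpha> \<Longrightarrow> length xs = k \<Longrightarrow> set xs \<subseteq> \<gg> \<Longrightarrow> i < k \<Longrightarrow> x \<in> \<gg> \<Longrightarrow> y \<in> \<gg> \<Longrightarrow>
    \<alpha> (xs[i := x + y]) = \<alpha> (xs[i := x]) + \<alpha> (xs[i := y])"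
  by (simp add: multilinear_form_def)

lemma multilinear_form_scale:
  "multilinear_form \<gg> k \<alpha> \<Longrightarrow> length xs = k \<Longrightarrow> set xs \<subseteq> \<gg> \<Longrightarrow> i < k \<Longrightarrow> x \<in> \<gg> \<Longrightarrow>
    \<alpha> (xs[i := c *\<^sub>R x]) = c * \<alpha> (xs[i := x])"
  by (simp add: multilinear_form_def)

text \<open>A tensor product of alternating forms need not be alternating, so only multilinearity is
  carried through it; \<open>alternation\<close> restores the rest.\<close>

lemma multilinear_form_tensor:
  assumes \<alpha>: "multilinear_form \<gg> p \<alpha>" and \<beta>: "multilinear_form \<gg> q \<beta>"
  shows "multilinear_form \<gg> (p + q) (\<lambda>ys. \<alpha> (take p ys) * \<beta> (drop p ys))"
proof -
  have take: "take p (xs[i := u]) = (if i < p then (take p xs)[i := u] else take p xs)"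
    and drop: "drop p (xs[i := u]) = (if i < p then drop p xs else (drop p xs)[i - p := u])"
    for xs :: "'a list" and i u
    by (simp_all add: take_update_swap drop_update_swap list_update_beyond)
  show ?thesis
    unfolding multilinear_form_def
  proof (intro allI impI conjI ballI; elim conjE)
    fix xs i x y assume *: "length xs = p + q" "set xs \<subseteq> \<gg>" "i < p + q" "x \<in> \<gg>" "y \<in> \<gg>"
    have **: "length (take p xs) = p" "length (drop p xs) = q" "set (take p xs) \<subseteq> \<gg>"
      "set (drop p xs) \<subseteq> \<gg>" "\<not> i < p \<Longrightarrow> i - p < q"
      using *(1-3) set_take_subset[of p xs] set_drop_subset[of p xs] by auto
    show "\<alpha> (take p (xs[i := x + y])) * \<beta> (drop p (xs[i := x + y])) =
        \<alpha> (take p (xs[i := x])) * \<beta> (drop p (xs[i := x])) +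
        \<alpha> (take p (xs[i := y])) * \<beta> (drop p (xs[i := y]))"
      using multilinear_form_add[OF \<alpha> **(1,3) _ *(4,5), of i]
        multilinear_form_add[OF \<beta> **(2,4) **(5) *(4,5)]
      by (cases "i < p") (simp_all only: take drop if_True if_False distrib_left distrib_right
          not_False_eq_True)
  next
    fix xs i x c assume *: "length xs = p + q" "set xs \<subseteq> \<gg>" "i < p + q" "x \<in> \<gg>"
    have **: "length (take p xs) = p" "length (drop p xs) = q" "set (take p xs) \<subseteq> \<gg>"
      "set (drop p xs) \<subseteq> \<gg>" "\<not> i < p \<Longrightarrow> i - p < q"
      using *(1-3) set_take_subset[of p xs] set_drop_subset[of p xs] by auto
    show "\<alpha> (take p (xs[i := c *\<^sub>R x])) * \<beta> (drop p (xs[i := c *\<^sub>R x])) =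
        c * (\<alpha> (take p (xs[i := x])) * \<beta> (drop p (xs[i := x])))"
      using multilinear_form_scale[OF \<alpha> **(1,3) _ *(4), of i c]
        multilinear_form_scale[OF \<beta> **(2,4) **(5) *(4), of c]
      by (cases "i < p") (simp_all only: take drop if_True if_False mult_ac not_False_eq_True)
  qed
qed

lemma alt_form_alternation:
  assumes f: "multilinear_form \<gg> k f"
  shows "alt_form \<gg> k (alternation k f)"
proof -
  have inv: "inv \<sigma> i < k" if "\<sigma> permutes {..<k}" "i < k" for \<sigma> i
    using permutes_in_image[OF permutes_inv[OF that(1)]] that(2) by auto
  show ?thesis
    unfolding alt_form_def
  proof (intro allI impI conjI ballI; elim conjE)
    fix xs i x y assume "length xs = k" "set xs \<subseteq> \<gg>" "i < k" "x \<in> \<gg>" "y \<in> \<gg>"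
    then show "alternation k f (xs[i := x + y]) =
        alternation k f (xs[i := x]) + alternation k f (xs[i := y])"
      unfolding alternation_def sum.distrib[symmetric]
      by (intro sum.cong refl)
         (simp add: permute_list_update multilinear_form_add[OF f] inv algebra_simps)
  next
    fix xs i x c assume "length xs = k" "set xs \<subseteq> \<gg>" "i < k" "x \<in> \<gg>"
    then show "alternation k f (xs[i := c *\<^sub>R x]) = c * alternation k f (xs[i := x])"
      unfolding alternation_def sum_distrib_left
      by (intro sum.cong refl)
         (simp add: permute_list_update multilinear_form_scale[OF f] inv algebra_simps)
  qed (use alternation_repeated in blast)
qed

lemma alt_form_divide: "alt_form \<gg> k \<alpha> \<Longrightarrow> alt_form \<gg> k (\<lambda>xs. \<alpha> xs / c)"
  by (simp add: alt_form_def add_divide_distrib)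

text \<open>Bridges the fact that \<open>wedge\<close> is known to agree with an alternation only on
  lists of the right length.\<close>

lemma alt_form_cong:
  assumes eq: "\<And>xs. length xs = k \<Longrightarrow> set xs \<subseteq> \<gg> \<Longrightarrow> \<alpha> xs = \<beta> xs" and "subspace \<gg>"
    and \<alpha>: "alt_form \<gg> k \<alpha>"
  shows "alt_form \<gg> k \<beta>"
proof -
  have upd: "\<beta> (xs[i := x]) = \<alpha> (xs[i := x])" 
    if "length xs = k" "set xs \<subseteq> \<gg>" "x \<in> \<gg>" for xs i x
    using that set_update_subset_insert[of xs i x] by (intro eq[symmetric]) auto
  show ?thesis
    using \<alpha> assms(2) unfolding alt_form_def
    by (simp add: upd eq[symmetric] subspace_add subspace_scale)
qed

lemma alt_form_wedge:
  assumes "subspace \<gg>" "alt_form \<gg> p \<alpha>" "alt_form \<gg> q \<beta>"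
  shows "alt_form \<gg> (p + q) (wedge p q \<alpha> \<beta>)"
  by (rule alt_form_cong[OF wedge_eq_alternation[symmetric] assms(1)])
     (simp_all add: alt_form_divide alt_form_alternation multilinear_form_tensor
        alt_form_multilinear assms)

lemma alt_form_wedge_power:
  assumes "subspace \<gg>" "alt_form \<gg> p \<alpha>"
  shows "alt_form \<gg> (m * p) (wedge_power p \<alpha> m)"
proof (induction m)
  case 0
  show ?case by (simp add: alt_form_def)
next
  case (Suc m)
  then show ?case using alt_form_wedge[OF assms(1,2)] by simp
qed

section \<open>Permutations of a final block of positions\<close>

definition shift_permutation :: "nat \<Rightarrow> (nat \<Rightarrow> nat) \<Rightarrow> nat \<Rightarrow> nat" where
  "shift_permutation p \<tau> i = (if i < p then i else \<tau> (i - p) + p)"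

lemma bij_betw_add_const: "bij_betw (\<lambda>i. i + p) {..<q} {p..<p + q :: nat}"
  by (rule bij_betwI[where g = "\<lambda>i. i - p"]) auto

lemma shift_permutation_eq_map_permutation:
  assumes \<tau>: "\<tau> permutes {..<q}"
  shows "shift_permutation p \<tau> = map_permutation {..<q} (\<lambda>i. i + p) \<tau>"
proof
  fix i
  show "shift_permutation p \<tau> i = map_permutation {..<q} (\<lambda>i. i + p) \<tau> i"
  proof (cases "i \<in> {p..<p + q}")
    case True
    then have "i = (i - p) + p" "i - p \<in> {..<q}" by auto
    then have "map_permutation {..<q} (\<lambda>i. i + p) \<tau> i = \<tau> (i - p) + p"
      using map_permutation_apply[of "\<lambda>i. i + p" "{..<q}" "i - p" \<tau>] bij_betw_add_const
      by (auto simp: bij_betw_def)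
    with True show ?thesis by (auto simp: shift_permutation_def)
  next
    case False
    then have "map_permutation {..<q} (\<lambda>i. i + p) \<tau> i = i"
      using map_permutation_permutes[OF bij_betw_add_const \<tau>] by (meson permutes_not_in)
    moreover have "\<tau> (i - p) = i - p" if "i \<ge> p"
      using False that permutes_not_in[OF \<tau>, of "i - p"] by auto
    ultimately show ?thesis by (auto simp: shift_permutation_def)
  qed
qed

lemma shift_permutation_permutes:
  "\<tau> permutes {..<q} \<Longrightarrow> shift_permutation p \<tau> permutes {p..<p + q}"
  by (metis map_permutation_permutes[OF bij_betw_add_const] shift_permutation_eq_map_permutation)

lemma sign_shift_permutation:
  "\<tau> permutes {..<q} \<Longrightarrow> sign (shift_permutation p \<tau>) = sign \<tau>"
  by (simp add: shift_permutation_eq_map_permutation sign_map_permutation inj_on_def)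

text \<open>Shifting up and down by \<open>p\<close> are mutually inverse on permutations. With
  \<open>p = 1\<close>, the permutations of an initial segment that fix 0 become those of a segment
  shorter by one.\<close>

lemma sum_shift_permutation:
  "(\<Sum>\<tau> | \<tau> permutes {..<q}. G (shift_permutation p \<tau>)) = (\<Sum>\<sigma> | \<sigma> permutes {p..<p + q}. G \<sigma>)"
proof (rule sum.reindex_bij_witness[of _ "map_permutation {p..<p + q} (\<lambda>i. i - p)"
      "map_permutation {..<q} (\<lambda>i. i + p)"])
  have bij: "bij_betw (\<lambda>i. i - p) {p..<p + q} {..<q}"
    by (rule bij_betwI[where g = "\<lambda>i. i + p"]) auto
  fix \<sigma> assume "\<sigma> \<in> {\<sigma>. \<sigma> permutes {p..<p + q}}"
  then have \<sigma>: "\<sigma> permutes {p..<p + q}" by simp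
  show "map_permutation {..<q} (\<lambda>i. i + p) (map_permutation {p..<p + q} (\<lambda>i. i - p) \<sigma>) = \<sigma>"
    by (rule map_permutation_compose_inv[OF bij \<sigma>]) auto
  show "map_permutation {p..<p + q} (\<lambda>i. i - p) \<sigma> \<in> {\<tau>. \<tau> permutes {..<q}}"
    using map_permutation_permutes[OF bij \<sigma>] by simp
next
  fix \<tau> assume "\<tau> \<in> {\<tau>. \<tau> permutes {..<q}}"
  then have \<tau>: "\<tau> permutes {..<q}" by simp
  show "map_permutation {p..<p + q} (\<lambda>i. i - p) (map_permutation {..<q} (\<lambda>i. i + p) \<tau>) = \<tau>"
    by (rule map_permutation_compose_inv[OF bij_betw_add_const \<tau>]) auto
  show "map_permutation {..<q} (\<lambda>i. i + p) \<tau> \<in> {\<sigma>. \<sigma> permutes {p..<p + q}}"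
    using map_permutation_permutes[OF bij_betw_add_const \<tau>] by simp
  show "G (map_permutation {..<q} (\<lambda>i. i + p) \<tau>) = G (shift_permutation p \<tau>)"
    by (simp add: shift_permutation_eq_map_permutation[OF \<tau>])
qed

text \<open>An inner permutation \<open>\<tau>\<close> acts on the last \<open>q\<close> positions
  and can be composed into the outer one. For fixed \<open>\<tau>\<close> this merely reorders the
  outer sum, and there are \<open>fact q\<close> choices of \<open>\<tau>\<close>.\<close>

lemma alternation_tensor:
  fixes \<alpha> f :: "'a list \<Rightarrow> real"
  assumes len: "length xs = p + q"
  shows "alternation (p + q) (\<lambda>ys. \<alpha> (take p ys) * alternation q f (drop p ys)) xs
    = fact q * alternation (p + q) (\<lambda>ys. \<alpha> (take p ys) * f (drop p ys)) xs"
proof -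
  let ?P = "{\<sigma>. \<sigma> permutes {..<p + q}}"
  define G where "G \<sigma> = of_int (sign \<sigma>) *
    (\<alpha> (take p (permute_list \<sigma> xs)) * f (drop p (permute_list \<sigma> xs)))" for \<sigma>
  have shift: "shift_permutation p \<tau> permutes {..<p + q}" "sign (shift_permutation p \<tau>) = sign \<tau>"
    if "\<tau> permutes {..<q}" for \<tau>
    using permutes_subset[OF shift_permutation_permutes[OF that, of p], of "{..<p + q}"]
      sign_shift_permutation[OF that] by (auto simp: subset_iff)
  have pl: "take p (permute_list (\<sigma> \<circ> shift_permutation p \<tau>) xs) = take p (permute_list \<sigma> xs)"
    "drop p (permute_list (\<sigma> \<circ> shift_permutation p \<tau>) xs) = permute_list \<tau> (drop p (permute_list \<sigma> xs))"
    if "\<tau> permutes {..<q}" for \<sigma> \<tau>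
  proof -
    have \<tau>: "\<tau> i < q" if "i < q" for i
      using permutes_in_image[OF \<open>\<tau> permutes {..<q}\<close>] that by auto
    show "take p (permute_list (\<sigma> \<circ> shift_permutation p \<tau>) xs) = take p (permute_list \<sigma> xs)"
      by (rule nth_equalityI) (use len in \<open>auto simp: permute_list_def shift_permutation_def\<close>)
    show "drop p (permute_list (\<sigma> \<circ> shift_permutation p \<tau>) xs) = permute_list \<tau> (drop p (permute_list \<sigma> xs))"
      by (rule nth_equalityI)
         (use len \<tau> in \<open>auto simp: permute_list_def shift_permutation_def add.commute\<close>)
  qed
  have "alternation (p + q) (\<lambda>ys. \<alpha> (take p ys) * alternation q f (drop p ys)) xs
    = (\<Sum>\<sigma>\<in>?P. \<Sum>\<tau> | \<tau> permutes {..<q}. G (\<sigma> \<circ> shift_permutation p \<tau>))"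
    unfolding alternation_def[of "p + q"]
  proof (rule sum.cong[OF refl])
    fix \<sigma> assume "\<sigma> \<in> ?P"
    then have "sign (\<sigma> \<circ> shift_permutation p \<tau>) = sign \<sigma> * sign \<tau>" if "\<tau> permutes {..<q}" for \<tau>
      using sign_compose_permutes[of "{..<p + q}" \<sigma> "shift_permutation p \<tau>"] shift[OF that] by simp
    then show "of_int (sign \<sigma>) * (\<alpha> (take p (permute_list \<sigma> xs)) *
        alternation q f (drop p (permute_list \<sigma> xs)))
      = (\<Sum>\<tau> | \<tau> permutes {..<q}. G (\<sigma> \<circ> shift_permutation p \<tau>))"
      unfolding alternation_def[of q] sum_distrib_left G_def
      by (intro sum.cong refl) (auto simp: pl)
  qed
  also have "\<dots> = (\<Sum>\<tau> | \<tau> permutes {..<q}. \<Sum>\<sigma>\<in>?P. G (\<sigma> \<circ> shift_permutation p \<tau>))"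
    by (rule sum.swap)
  also have "\<dots> = (\<Sum>\<tau> | \<tau> permutes {..<q}. sum G ?P)"
    by (intro sum.cong refl sum_permutations_compose_right[symmetric]) (use shift in auto)
  also have "\<dots> = fact q * sum G ?P"
    by (simp add: card_permutations)
  finally show ?thesis by (simp add: G_def alternation_def)
qed

primrec tensor_power2 :: "('a list \<Rightarrow> real) \<Rightarrow> nat \<Rightarrow> 'a list \<Rightarrow> real" where
  "tensor_power2 \<Omega> 0 = (\<lambda>ys. 1)"
| "tensor_power2 \<Omega> (Suc m) = (\<lambda>ys. \<Omega> (take 2 ys) * tensor_power2 \<Omega> m (drop 2 ys))"

lemma tensor_power2_eq_prod:
  "length ys = 2 * m \<Longrightarrow> tensor_power2 \<Omega> m ys = (\<Prod>i<m. \<Omega> [ys ! (2 * i), ys ! Suc (2 * i)])"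
proof (induction m arbitrary: ys)
  case (Suc m)
  then have "length ys = Suc (Suc (2 * m))" by simp
  then obtain a b zs where "ys = a # b # zs"
    unfolding length_Suc_conv by blast
  with Suc show ?case by (simp add: prod.lessThan_Suc_shift numeral_2_eq_2 del: prod.lessThan_Suc)
qed simp

text \<open>The \<open>fact q\<close> gained by absorbing the inner alternation cancels the one in
  the denominator of the wedge product.\<close>

lemma wedge_alternation:
  assumes "length xs = p + q"
    and "\<And>ys. length ys = q \<Longrightarrow> set ys \<subseteq> set xs \<Longrightarrow> \<beta> ys = alternation q f ys / c"
  shows "wedge p q \<alpha> \<beta> xs =
    alternation (p + q) (\<lambda>ys. \<alpha> (take p ys) * f (drop p ys)) xs / (fact p * c)"
proof -
  have "wedge p q \<alpha> \<beta> xs = alternation (p + q)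
      (\<lambda>ys. \<alpha> (take p ys) * (alternation q f (drop p ys) / c)) xs / (fact p * fact q)"
    unfolding wedge_eq_alternation[OF assms(1)]
    by (intro arg_cong2[where f = "(/)"] alternation_cong refl assms(1)
          arg_cong2[where f = "(*)"] assms(2))
       (use assms(1) in \<open>auto dest: in_set_dropD\<close>)
  also have "\<dots> = alternation (p + q)
      (\<lambda>ys. \<alpha> (take p ys) * alternation q f (drop p ys)) xs / (fact p * fact q * c)"
    by (simp add: alternation_def[of "p + q"] sum_divide_distrib mult_ac)
  finally show ?thesis
    by (simp add: alternation_tensor[OF assms(1)])
qed

text \<open>Each further wedge with the 2-form contributes only \<open>fact 2\<close> to the
  denominator, whence \<open>2 ^ m\<close>.\<close>

lemma wedge_power2_eq_alternation:
  "length xs = m * 2 \<Longrightarrow> wedge_power 2 \<Omega> m xs = alternation (m * 2) (tensor_power2 \<Omega> m) xs / 2 ^ m"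
proof (induction m arbitrary: xs)
  case 0
  then show ?case by (simp add: alternation_def)
next
  case (Suc m)
  then show ?case
    using wedge_alternation[of xs 2 "m * 2" "wedge_power 2 \<Omega> m" "tensor_power2 \<Omega> m" "2 ^ m" \<Omega>]
    by simp
qed

section \<open>Powers of a 2-form\<close>

text \<open>Polarisation: \<open>\<Omega>\<close> vanishes on \<open>[x + y, x + y]\<close>, and
  expanding leaves only the mixed terms.\<close>

lemma alt_form_2_swap:
  assumes \<Omega>: "alt_form \<gg> 2 \<Omega>" and "subspace \<gg>" "x \<in> \<gg>" "y \<in> \<gg>"
  shows "\<Omega> [x, y] = - \<Omega> [y, x]"
proof -
  have *: "\<Omega> [u + v, w] = \<Omega> [u, w] + \<Omega> [v, w]" "\<Omega> [w, u + v] = \<Omega> [w, u] + \<Omega> [w, v]"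
    "\<Omega> [u, u] = 0" if "u \<in> \<gg>" "v \<in> \<gg>" "w \<in> \<gg>" for u v w
    using multilinear_form_add[OF alt_form_multilinear[OF \<Omega>], of "[w, w]" 0 u v]
      multilinear_form_add[OF alt_form_multilinear[OF \<Omega>], of "[w, w]" 1 u v] that
      alt_form_repeated[OF \<Omega>, of "[u, u]" 0 1]
    by auto
  have xy: "x + y \<in> \<gg>" using assms by (simp add: subspace_add)
  have "\<Omega> [x + y, x + y] = \<Omega> [x, x] + \<Omega> [x, y] + (\<Omega> [y, x] + \<Omega> [y, y])"
    using *(1)[OF assms(3,4) xy] *(2)[OF assms(3,4) assms(3)] *(2)[OF assms(3,4) assms(4)] by simp
  then show ?thesis using *(3)[OF xy xy xy] *(3)[of x] *(3)[of y] assms by simp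
qed

text \<open>Expanding the entries one at a time in \<open>B\<close> reduces to lists from
  \<open>B\<close>, and those with a repetition vanish because the form is alternating.\<close>

lemma alt_form_eq_0_on_span:
  assumes \<Phi>: "alt_form \<gg> k \<Phi>" and sub: "subspace \<gg>" and B: "B \<subseteq> \<gg>" "\<gg> \<subseteq> span B"
    and zero: "\<And>bs. set bs \<subseteq> B \<Longrightarrow> distinct bs \<Longrightarrow> length bs = k \<Longrightarrow> \<Phi> bs = 0"
    and xs: "length xs = k" "set xs \<subseteq> \<gg>"
  shows "\<Phi> xs = 0"
proof -
  \<comment> \<open>The first \<open>j\<close> entries may be arbitrary in \<open>\<gg>\<close>, the
    others lie in \<open>B\<close>; the claim is the case \<open>j = k\<close>.\<close>
  have "\<Phi> xs = 0"
    if "length xs = k" "set xs \<subseteq> \<gg>" "\<And>i. j \<le> i \<Longrightarrow> i < k \<Longrightarrow> xs ! i \<in> B" for j xs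
    using that
  proof (induction j arbitrary: xs)
    case 0
    show ?case
    proof (cases "distinct xs")
      case True
      moreover have "set xs \<subseteq> B" using 0 by (auto simp: set_conv_nth)
      ultimately show ?thesis using zero 0 by blast
    next
      case False
      then obtain i j where "i < j" "j < k" "xs ! i = xs ! j"
        using 0 by (metis distinct_conv_nth linorder_neqE_nat)
      then show ?thesis using \<Phi> 0 unfolding alt_form_def by blast
    qed
  next
    case (Suc j)
    show ?case
    proof (cases "j < k")
      case False
      then show ?thesis using Suc by (metis Suc.IH leD le_trans nat_le_linear not_less)
    next
      case True
      \<comment> \<open>Membership in \<open>\<gg>\<close> is carried along because additivity of
        the form is available only there.\<close>
      have "v \<in> \<gg> \<and> \<Phi> (xs[j := v]) = 0" if "v \<in> span B" for v
        using that
      proof (induction rule: span_induct_alt)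
        case base
        have "0 \<in> \<gg>" using sub by (rule subspace_0)
        then show ?case
          using multilinear_form_scale[OF alt_form_multilinear[OF \<Phi>] Suc.prems(1,2) True, of 0 0]
          by simp
      next
        case (step c x y)
        then have x: "x \<in> \<gg>" using B by blast
        then have cx: "c *\<^sub>R x \<in> \<gg>" using sub by (simp add: subspace_scale)
        have "\<Phi> (xs[j := x]) = 0"
        proof (rule Suc.IH)
          show "set (xs[j := x]) \<subseteq> \<gg>"
            using set_update_subset_insert[of xs j x] Suc.prems x by auto
          show "xs[j := x] ! i \<in> B" if "j \<le> i" "i < k" for i
            using that Suc.prems step by (cases "i = j") auto
        qed (use Suc.prems in simp)
        then show ?case
          using step x cx sub
            multilinear_form_add[OF alt_form_multilinear[OF \<Phi>] Suc.prems(1,2) True cx, of y]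
            multilinear_form_scale[OF alt_form_multilinear[OF \<Phi>] Suc.prems(1,2) True x, of c]
          by (auto simp: subspace_add)
      qed
      moreover have "xs ! j \<in> span B" using Suc.prems True B by (metis nth_mem subsetD)
      ultimately show ?thesis by (metis list_update_id)
    qed
  qed
  from this[of xs k] show ?thesis using xs by auto
qed

text \<open>After any permutation, \<open>v\<close> is an argument of one factor of the product, and
  that factor is zero.\<close>

lemma wedge_power2_eq_0_if_kernel:
  assumes \<Omega>: "alt_form \<gg> 2 \<Omega>" and sub: "subspace \<gg>" and v: "v \<in> \<gg>"
    and ker: "\<And>y. y \<in> \<gg> \<Longrightarrow> \<Omega> [v, y] = 0"
    and xs: "length xs = m * 2" "set xs \<subseteq> \<gg>" "v \<in> set xs"
  shows "wedge_power 2 \<Omega> m xs = 0"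
proof -
  have "tensor_power2 \<Omega> m (permute_list \<sigma> xs) = 0" if \<sigma>: "\<sigma> permutes {..<m * 2}" for \<sigma>
  proof -
    let ?ys = "permute_list \<sigma> xs"
    have ys: "set ?ys = set xs" "length ?ys = 2 * m" using \<sigma> xs by auto
    then obtain l where l: "l < 2 * m" "?ys ! l = v" using xs by (metis in_set_conv_nth)
    have in_g: "?ys ! j \<in> \<gg>" if "j < 2 * m" for j using that ys xs by (metis nth_mem subsetD)
    \<comment> \<open>Position \<open>l\<close> belongs to factor \<open>l div 2\<close>, as its
      first or second argument according to parity.\<close>
    define i where "i = l div 2"
    then have i: "i < m" "l = 2 * i \<or> l = Suc (2 * i)" using l by auto
    then have "\<Omega> [?ys ! (2 * i), ?ys ! Suc (2 * i)] = 0"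
    proof (elim disjE)
      assume "l = 2 * i"
      then show ?thesis using l i in_g[of "Suc (2 * i)"] ker by simp
    next
      assume "l = Suc (2 * i)"
      then show ?thesis
        using l i in_g[of "2 * i"] ker[of "?ys ! (2 * i)"]
          alt_form_2_swap[OF \<Omega> sub, of "?ys ! (2 * i)" v] v by simp
    qed
    then show ?thesis
      using i ys by (subst tensor_power2_eq_prod) (auto intro!: prod_zero)
  qed
  then show ?thesis
    by (simp add: wedge_power2_eq_alternation[OF xs(1)] alternation_def)
qed

text \<open>Complete \<open>v\<close> to a basis: a list of \<open>2 * n\<close> distinct basis
  vectors uses all of them, hence contains \<open>v\<close>.\<close>

lemma form_eq_wedge_power2_zero_if_degenerate:
  assumes \<Omega>: "alt_form \<gg> 2 \<Omega>" and sub: "subspace \<gg>" and dim: "dim \<gg> = 2 * n" and n: "n > 0"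
    and v: "v \<in> \<gg>" "v \<noteq> 0" and ker: "\<And>y. y \<in> \<gg> \<Longrightarrow> \<Omega> [v, y] = 0"
  shows "form_eq \<gg> (2 * n) (wedge_power 2 \<Omega> n) zero_form"
proof -
  obtain B where B: "{v} \<subseteq> B" "B \<subseteq> \<gg>" "independent B" "\<gg> \<subseteq> span B"
    using maximal_independent_subset_extend[of "{v}" \<gg>] v by auto
  have card: "card B = 2 * n" using basis_card_eq_dim[OF B(2,4,3)] dim by simp
  then have fin: "finite B" using n by (metis card.infinite mult_eq_0_iff neq0_conv zero_neq_numeral)
  have "wedge_power 2 \<Omega> n xs = 0" if "length xs = n * 2" "set xs \<subseteq> \<gg>" for xs
  proof (rule alt_form_eq_0_on_span[OF alt_form_wedge_power[OF sub \<Omega>] sub B(2,4) _ that])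
    fix bs :: "'a list" assume bs: "set bs \<subseteq> B" "distinct bs" "length bs = n * 2"
    then have "set bs = B" using card fin by (intro card_subset_eq) (auto simp: distinct_card)
    then show "wedge_power 2 \<Omega> n bs = 0"
      using bs B by (intro wedge_power2_eq_0_if_kernel[OF \<Omega> sub v(1) ker]) auto
  qed
  then show ?thesis by (simp add: form_eq_def zero_form_def mult.commute)
qed

text \<open>
  The two entries of the \<open>i\<close>-th factor of \<open>\<Omega>\<^sup>k\<^sup>+\<^sup>1\<close> may be exchanged, and so may the first and
  the \<open>i\<close>-th factor; hence every position that \<open>x\<close> can take contributes the same amount.
\<close>

lemma interior_product_wedge_power2:
  assumes \<Omega>: "alt_form \<gg> 2 \<Omega>" and sub: "subspace \<gg>" and x: "x \<in> \<gg>"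
    and ys: "length ys = Suc (k * 2)" "set ys \<subseteq> \<gg>"
  shows "interior_product x (wedge_power 2 \<Omega> (Suc k)) ys =
    real (Suc k) * wedge 1 (k * 2) (interior_product x \<Omega>) (wedge_power 2 \<Omega> k) ys"
proof -
  let ?N = "2 * Suc k" and ?P = "{\<sigma>. \<sigma> permutes {..<2 * Suc k}}"
  define z where "z = x # ys"
  define w where "w a b = \<Omega> [z ! a, z ! b]" for a b
  define F where "F \<sigma> = of_int (sign \<sigma>) * (\<Prod>l<Suc k. w (\<sigma> (2 * l)) (\<sigma> (Suc (2 * l))))" for \<sigma>
  \<comment> \<open>Index 0 of \<open>z\<close> is \<open>x\<close>, so \<open>S p\<close> collects
    the terms in which \<open>x\<close> stands at position \<open>p\<close>.\<close>
  define S where "S p = (\<Sum>\<sigma>\<in>?P. if \<sigma> p = 0 then F \<sigma> else 0)" for p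
  have z: "length z = ?N" "set z \<subseteq> \<gg>" using x ys by (auto simp: z_def)
  have in_g: "z ! a \<in> \<gg>" if "a < ?N" for a using z that by (metis nth_mem subsetD)
  have w_swap: "w a b = - w b a" if "a < ?N" "b < ?N" for a b
    unfolding w_def using alt_form_2_swap[OF \<Omega> sub in_g in_g] that .
  have lt: "\<sigma> a < ?N" if "\<sigma> \<in> ?P" "a < ?N" for \<sigma> a
    using permutes_in_image[of \<sigma> "{..<?N}" a] that by auto
  have F: "of_int (sign \<sigma>) * tensor_power2 \<Omega> (Suc k) (permute_list \<sigma> z) = F \<sigma>" if "\<sigma> \<in> ?P" for \<sigma>
    unfolding F_def using that z
    by (subst tensor_power2_eq_prod)
       (auto simp: w_def permute_list_def simp del: prod.lessThan_Suc upt_Suc intro!: prod.cong)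
  have S_odd: "S (Suc (2 * i)) = S (2 * i)" if i: "i < Suc k" for i
  proof -
    let ?\<tau> = "transpose (2 * i) (Suc (2 * i))"
    have \<tau>: "?\<tau> permutes {..<?N}" by (rule permutes_swap_id) (use i in auto)
    have "F (\<sigma> \<circ> ?\<tau>) = F \<sigma>" if \<sigma>: "\<sigma> \<in> ?P" for \<sigma>
    proof -
      have "(\<Prod>l<Suc k. w ((\<sigma> \<circ> ?\<tau>) (2 * l)) ((\<sigma> \<circ> ?\<tau>) (Suc (2 * l)))) =
          w (\<sigma> (Suc (2 * i))) (\<sigma> (2 * i)) *
          (\<Prod>l\<in>{..<Suc k} - {i}. w ((\<sigma> \<circ> ?\<tau>) (2 * l)) ((\<sigma> \<circ> ?\<tau>) (Suc (2 * l))))"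
        using i by (subst prod.remove[of _ i]) auto
      also have "(\<Prod>l\<in>{..<Suc k} - {i}. w ((\<sigma> \<circ> ?\<tau>) (2 * l)) ((\<sigma> \<circ> ?\<tau>) (Suc (2 * l)))) =
          (\<Prod>l\<in>{..<Suc k} - {i}. w (\<sigma> (2 * l)) (\<sigma> (Suc (2 * l))))"
        by (intro prod.cong refl) (auto simp: transpose_def; presburger)
      also have "w (\<sigma> (Suc (2 * i))) (\<sigma> (2 * i)) = - w (\<sigma> (2 * i)) (\<sigma> (Suc (2 * i)))"
        using lt[OF \<sigma>] i by (intro w_swap) auto
      finally have "(\<Prod>l<Suc k. w ((\<sigma> \<circ> ?\<tau>) (2 * l)) ((\<sigma> \<circ> ?\<tau>) (Suc (2 * l)))) =
          - (\<Prod>l<Suc k. w (\<sigma> (2 * l)) (\<sigma> (Suc (2 * l))))"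
        using i prod.remove[of "{..<Suc k}" i "\<lambda>l. w (\<sigma> (2 * l)) (\<sigma> (Suc (2 * l)))"] by simp
      moreover have "sign (\<sigma> \<circ> ?\<tau>) = - sign \<sigma>"
        using sign_compose_permutes[OF _ _ \<tau>, of \<sigma>] \<sigma> by (simp add: sign_swap_id)
      ultimately show ?thesis unfolding F_def by (simp del: prod.lessThan_Suc)
    qed
    then show ?thesis
      unfolding S_def by (subst sum_permutations_compose_right[OF \<tau>]) (auto intro!: sum.cong)
  qed
  have S_even: "S (2 * i) = S 0" if i: "i < Suc k" for i
  proof -
    \<comment> \<open>Exchanging factor 0 with factor \<open>i\<close> moves two pairs of positions,
      an even permutation; for \<open>i = 0\<close> both transpositions are the identity. On the
      indices of factors it acts as \<open>?t\<close>.\<close>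
    let ?\<tau> = "transpose 0 (2 * i) \<circ> transpose 1 (Suc (2 * i))" and ?t = "transpose 0 i"
    have perm: "transpose 0 (2 * i) permutes {..<?N}" "transpose 1 (Suc (2 * i)) permutes {..<?N}"
      by (rule permutes_swap_id; use i in auto)+
    then have \<tau>: "?\<tau> permutes {..<?N}" by (intro permutes_compose)
    have t: "?t permutes {..<Suc k}" by (rule permutes_swap_id) (use i in auto)
    have sign: "sign ?\<tau> = 1"
      using sign_compose_permutes[OF finite_lessThan perm] by (simp add: sign_swap_id)
    have parity: "2 * a \<noteq> Suc (2 * b)" for a b by presburger
    have \<tau>_eq: "?\<tau> (2 * l) = 2 * ?t l" "?\<tau> (Suc (2 * l)) = Suc (2 * ?t l)" for l
      using parity parity[symmetric] by (simp_all add: transpose_def)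
    have "F (\<sigma> \<circ> ?\<tau>) = F \<sigma>" if \<sigma>: "\<sigma> \<in> ?P" for \<sigma>
    proof -
      have "(\<Prod>l<Suc k. w ((\<sigma> \<circ> ?\<tau>) (2 * l)) ((\<sigma> \<circ> ?\<tau>) (Suc (2 * l)))) =
          prod ((\<lambda>l. w (\<sigma> (2 * l)) (\<sigma> (Suc (2 * l)))) \<circ> ?t) {..<Suc k}"
        using \<tau>_eq by (intro prod.cong refl) simp
      also have "\<dots> = (\<Prod>l<Suc k. w (\<sigma> (2 * l)) (\<sigma> (Suc (2 * l))))"
        by (rule prod.permute[OF t, symmetric])
      finally show ?thesis
        using sign_compose_permutes[OF _ _ \<tau>, of \<sigma>] \<sigma> sign unfolding F_def by simp
    qed
    moreover have "?\<tau> (2 * i) = 0" using \<tau>_eq(1)[of i] by simp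
    ultimately show ?thesis
      unfolding S_def by (subst sum_permutations_compose_right[OF \<tau>]) (auto intro!: sum.cong)
  qed
  have S: "S p = S 0" if "p < ?N" for p
  proof (cases "even p")
    case True
    then show ?thesis using S_even[of "p div 2"] that by auto
  next
    case False
    then show ?thesis
      using S_even[of "p div 2"] S_odd[of "p div 2"] that by (auto elim!: oddE)
  qed
  have "alternation ?N (tensor_power2 \<Omega> (Suc k)) z = sum F ?P"
    unfolding alternation_def using F by (intro sum.cong) auto
  \<comment> \<open>Every permutation takes the value 0 at exactly one position,
    \<open>inv \<sigma> 0\<close>.\<close>
  also have "\<dots> = (\<Sum>\<sigma>\<in>?P. \<Sum>p<?N. if \<sigma> p = 0 then F \<sigma> else 0)"
  proof (intro sum.cong refl)
    fix \<sigma> assume "\<sigma> \<in> ?P"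
    then have \<sigma>: "\<sigma> permutes {..<?N}" by simp
    have "inv \<sigma> 0 < ?N" using permutes_in_image[OF permutes_inv[OF \<sigma>], of 0] by auto
    then show "F \<sigma> = (\<Sum>p<?N. if \<sigma> p = 0 then F \<sigma> else 0)"
      by (simp add: permutes_inv_eq[OF \<sigma>, symmetric] eq_commute[of _ "inv \<sigma> 0"]
          del: sum.lessThan_Suc)
  qed
  also have "\<dots> = (\<Sum>p<?N. S p)" unfolding S_def by (rule sum.swap)
  also have "\<dots> = (\<Sum>p<?N. S 0)" by (intro sum.cong refl S) simp
  also have "\<dots> = ?N * S 0" by (simp only: sum_constant card_lessThan)
  finally have lhs: "alternation ?N (tensor_power2 \<Omega> (Suc k)) z = ?N * S 0" .
  \<comment> \<open>A permutation fixing 0 amounts to a permutation of the remaining positions,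
    which index the entries of \<open>ys\<close>.\<close>
  have "S 0 = sum F {\<sigma>. \<sigma> permutes {1..<1 + Suc (k * 2)}}"
  proof -
    have "\<sigma> permutes {1..<1 + Suc (k * 2)} \<longleftrightarrow> \<sigma> permutes {..<?N} \<and> \<sigma> 0 = 0" for \<sigma> :: "nat \<Rightarrow> nat"
    proof
      assume *: "\<sigma> permutes {1..<1 + Suc (k * 2)}"
      then show "\<sigma> permutes {..<?N} \<and> \<sigma> 0 = 0"
        using permutes_subset[OF *, of "{..<?N}"] permutes_not_in[OF *, of 0]
        by (auto simp: subset_iff)
    next
      assume *: "\<sigma> permutes {..<?N} \<and> \<sigma> 0 = 0"
      have "x = 0" if "x \<in> {..<?N} - {1..<1 + Suc (k * 2)}" for x
        using that by auto
      with * show "\<sigma> permutes {1..<1 + Suc (k * 2)}"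
        by (blast intro: permutes_superset)
    qed
    then show ?thesis
      unfolding S_def by (simp add: sum.inter_filter[symmetric] finite_permutations)
  qed
  also have "\<dots> = (\<Sum>\<tau> | \<tau> permutes {..<Suc (k * 2)}. F (shift_permutation 1 \<tau>))"
    by (rule sum_shift_permutation[symmetric])
  also have "\<dots> = alternation (1 + k * 2)
      (\<lambda>us. interior_product x \<Omega> (take 1 us) * tensor_power2 \<Omega> k (drop 1 us)) ys"
    unfolding alternation_def plus_1_eq_Suc
  proof (intro sum.cong refl)
    fix \<tau> assume "\<tau> \<in> {\<tau>. \<tau> permutes {..<Suc (k * 2)}}"
    then have \<tau>: "\<tau> permutes {..<Suc (k * 2)}" by simp
    have "(\<Prod>l<Suc k. w (shift_permutation 1 \<tau> (2 * l)) (shift_permutation 1 \<tau> (Suc (2 * l)))) =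
        \<Omega> [x, ys ! \<tau> 0] * (\<Prod>l<k. \<Omega> [ys ! \<tau> (Suc (2 * l)), ys ! \<tau> (2 + 2 * l)])"
      unfolding prod.lessThan_Suc_shift
      by (simp add: shift_permutation_def w_def z_def)
    also have "(\<Prod>l<k. \<Omega> [ys ! \<tau> (Suc (2 * l)), ys ! \<tau> (2 + 2 * l)]) =
        tensor_power2 \<Omega> k (drop 1 (permute_list \<tau> ys))"
      using ys by (subst tensor_power2_eq_prod)
        (auto simp: permute_list_def simp del: upt_Suc intro!: prod.cong)
    also have "\<Omega> [x, ys ! \<tau> 0] = interior_product x \<Omega> (take 1 (permute_list \<tau> ys))"
      using ys by (simp add: permute_list_def interior_product_def upt_conv_Cons del: upt_Suc)
    finally show "F (shift_permutation 1 \<tau>) = of_int (sign \<tau>) *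
        (interior_product x \<Omega> (take 1 (permute_list \<tau> ys)) *
          tensor_power2 \<Omega> k (drop 1 (permute_list \<tau> ys)))"
      using sign_shift_permutation[OF \<tau>] by (simp add: F_def)
  qed
  finally have "wedge 1 (k * 2) (interior_product x \<Omega>) (wedge_power 2 \<Omega> k) ys = S 0 / 2 ^ k"
    using wedge_alternation[of ys 1 "k * 2" "wedge_power 2 \<Omega> k" "tensor_power2 \<Omega> k" "2 ^ k"
        "interior_product x \<Omega>"] ys by (simp add: wedge_power2_eq_alternation)
  moreover have "interior_product x (wedge_power 2 \<Omega> (Suc k)) ys = ?N * S 0 / 2 ^ Suc k"
    using wedge_power2_eq_alternation[of z "Suc k" \<Omega>] z lhs
    by (simp add: interior_product_def z_def mult.commute del: wedge_power.simps tensor_power2.simps)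
  \<comment> \<open>The two arguments of each factor account for the 2 that cancels; the
    \<open>Suc k\<close> factors remain.\<close>
  moreover have "?N * S 0 / 2 ^ Suc k = real (Suc k) * (S 0 / 2 ^ k)"
    by (simp add: field_simps)
  ultimately show ?thesis by (simp only:)
qed

section \<open>Congruence, contraction and restriction of forms\<close>

lemma wedge_cong:
  assumes "form_eq \<gg> p \<alpha> \<alpha>'" "form_eq \<gg> q \<beta> \<beta>'"
  shows "form_eq \<gg> (p + q) (wedge p q \<alpha> \<beta>) (wedge p q \<alpha>' \<beta>')"
  unfolding form_eq_def
proof (intro allI impI; elim conjE)
  fix xs :: "'a list" assume xs: "length xs = p + q" "set xs \<subseteq> \<gg>"
  have "\<alpha> (take p ys) = \<alpha>' (take p ys)" "\<beta> (drop p ys) = \<beta>' (drop p ys)"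
    if "length ys = p + q" "set ys = set xs" for ys
    using assms xs that set_take_subset[of p ys] set_drop_subset[of p ys] unfolding form_eq_def
    by auto
  then show "wedge p q \<alpha> \<beta> xs = wedge p q \<alpha>' \<beta>' xs"
    unfolding wedge_eq_alternation[OF xs(1)]
    by (intro arg_cong2[where f = "(/)"] alternation_cong refl xs) simp
qed

text \<open>Used to put \<open>\<Omega>\<close> for the differential of the contact form: the two
  agree as forms on the kernel of \<open>\<theta>\<close>, not necessarily as functions on
  lists.\<close>

lemma wedge_power_cong:
  assumes "form_eq \<gg> p \<alpha> \<alpha>'"
  shows "form_eq \<gg> (m * p) (wedge_power p \<alpha> m) (wedge_power p \<alpha>' m)"
proof (induction m)
  case (Suc m)
  then show ?case using wedge_cong[OF assms] by simp
qed (simp add: form_eq_def)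

lemma alt_form_interior_product:
  assumes \<alpha>: "alt_form \<gg> (Suc k) \<alpha>" and x: "x \<in> \<gg>"
  shows "alt_form \<gg> k (interior_product x \<alpha>)"
  unfolding alt_form_def interior_product_def
proof (intro allI impI conjI ballI; elim conjE)
  fix xs i u v assume *: "length xs = k" "set xs \<subseteq> \<gg>" "i < k" "u \<in> \<gg>" "v \<in> \<gg>"
  show "\<alpha> (x # xs[i := u + v]) = \<alpha> (x # xs[i := u]) + \<alpha> (x # xs[i := v])"
    using multilinear_form_add[OF alt_form_multilinear[OF \<alpha>], of "x # xs" "Suc i" u v] * x by simp
next
  fix xs i u c assume *: "length xs = k" "set xs \<subseteq> \<gg>" "i < k" "u \<in> \<gg>"
  show "\<alpha> (x # xs[i := c *\<^sub>R u]) = c * \<alpha> (x # xs[i := u])"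
    using multilinear_form_scale[OF alt_form_multilinear[OF \<alpha>], of "x # xs" "Suc i" u c] * x by simp
next
  fix xs i j assume *: "length xs = k" "set xs \<subseteq> \<gg>" "i < j" "j < k" "xs ! i = xs ! j"
  show "\<alpha> (x # xs) = 0"
    using alt_form_repeated[OF \<alpha>, of "x # xs" "Suc i" "Suc j"] * x by simp
qed

lemma alt_form_subset:
  assumes "alt_form \<gg> k \<alpha>" "\<hh> \<subseteq> \<gg>"
  shows "alt_form \<hh> k \<alpha>"
  unfolding alt_form_def
proof (intro allI impI)
  fix xs :: "'a list" assume "length xs = k \<and> set xs \<subseteq> \<hh>"
  then have "length xs = k \<and> set xs \<subseteq> \<gg>" using assms(2) by blast
  with assms(1) have
    "(\<forall>i<k. \<forall>x\<in>\<gg>. \<forall>y\<in>\<gg>. \<alpha> (xs[i := x + y]) = \<alpha> (xs[i := x]) + \<alpha> (xs[i := y])) \<and>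
     (\<forall>i<k. \<forall>x\<in>\<gg>. \<forall>c. \<alpha> (xs[i := c *\<^sub>R x]) = c * \<alpha> (xs[i := x])) \<and>
     (\<forall>i j. i < j \<and> j < k \<and> xs ! i = xs ! j \<longrightarrow> \<alpha> xs = 0)"
    unfolding alt_form_def by (elim allE[of _ xs] impE)
  with assms(2) show "(\<forall>i<k. \<forall>x\<in>\<hh>. \<forall>y\<in>\<hh>. \<alpha> (xs[i := x + y]) = \<alpha> (xs[i := x]) + \<alpha> (xs[i := y])) \<and>
     (\<forall>i<k. \<forall>x\<in>\<hh>. \<forall>c. \<alpha> (xs[i := c *\<^sub>R x]) = c * \<alpha> (xs[i := x])) \<and>
     (\<forall>i j. i < j \<and> j < k \<and> xs ! i = xs ! j \<longrightarrow> \<alpha> xs = 0)"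
    by blast
qed

section \<open>Testing a top power on a basis\<close>

lemma wedge_power2_permute_list:
  assumes \<tau>: "\<tau> permutes {..<m * 2}" and xs: "length xs = m * 2"
  shows "wedge_power 2 \<Omega> m (permute_list \<tau> xs) = of_int (sign \<tau>) * wedge_power 2 \<Omega> m xs"
  using xs by (simp add: wedge_power2_eq_alternation alternation_permute_list[OF \<tau>])

text \<open>A transposition brings \<open>x\<close> to the front at the cost of a sign; distinctness
  leaves only elements of \<open>B\<close> behind it.\<close>

lemma wedge_power2_eq_0_if_zero_on_Cons:
  assumes xs: "length xs = m * 2" "distinct xs" "set xs = insert x B"
    and zero: "\<And>ys. Suc (length ys) = m * 2 \<Longrightarrow> set ys \<subseteq> B \<Longrightarrow> wedge_power 2 \<Omega> m (x # ys) = 0"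
  shows "wedge_power 2 \<Omega> m xs = 0"
proof -
  have "x \<in> set xs" using xs(3) by simp
  then obtain i where i: "i < length xs" "xs ! i = x" unfolding in_set_conv_nth by blast
  let ?\<tau> = "transpose 0 i"
  have \<tau>: "?\<tau> permutes {..<m * 2}" by (rule permutes_swap_id) (use i xs(1) in simp_all)
  have \<tau>': "?\<tau> permutes {..<length xs}" using \<tau> xs(1) by simp
  have "0 < length xs" using i(1) by linarith
  then have "permute_list ?\<tau> xs ! 0 = x"
    using i(2) permute_list_nth[OF \<tau>', of 0] by simp
  moreover have "length (permute_list ?\<tau> xs) = m * 2" "m * 2 \<noteq> 0" using xs(1) i by simp_all
  ultimately obtain ys where ys: "permute_list ?\<tau> xs = x # ys"
    by (cases "permute_list ?\<tau> xs") simp_all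
  have "set (x # ys) = insert x B" "distinct (x # ys)" "length (x # ys) = m * 2"
    unfolding ys[symmetric] using xs \<tau>' by simp_all
  then have "wedge_power 2 \<Omega> m (x # ys) = 0"
    by (intro zero) auto
  then show ?thesis
    using wedge_power2_permute_list[OF \<tau> xs(1), of \<Omega>] unfolding ys by simp
qed

text \<open>A list of distinct vectors from \<open>insert x B\<close> of full length contains
  \<open>x\<close>. This carries nondegeneracy on \<open>\<gg>\<close> down to a hyperplane spanned
  by \<open>B\<close>.\<close>

lemma form_eq_wedge_power2_zero_if_zero_on_insert:
  assumes \<Omega>: "alt_form \<gg> 2 \<Omega>" and sub: "subspace \<gg>"
    and B: "insert x B \<subseteq> \<gg>" "\<gg> \<subseteq> span (insert x B)" "finite B" "card (insert x B) = m * 2"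
    and zero: "\<And>ys. Suc (length ys) = m * 2 \<Longrightarrow> set ys \<subseteq> B \<Longrightarrow> wedge_power 2 \<Omega> m (x # ys) = 0"
  shows "form_eq \<gg> (m * 2) (wedge_power 2 \<Omega> m) zero_form"
  unfolding form_eq_def zero_form_def
proof (intro allI impI; elim conjE)
  fix xs assume "length xs = m * 2" "set xs \<subseteq> \<gg>"
  then show "wedge_power 2 \<Omega> m xs = 0"
  proof (rule alt_form_eq_0_on_span[OF alt_form_wedge_power[OF sub \<Omega>] sub B(1,2), rotated])
    fix bs assume bs: "set bs \<subseteq> insert x B" "distinct bs" "length bs = m * 2"
    have "set bs = insert x B"
      by (rule card_subset_eq) (use B bs in \<open>simp_all add: distinct_card\<close>)
    then show "wedge_power 2 \<Omega> m bs = 0"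
      using wedge_power2_eq_0_if_zero_on_Cons[OF bs(3,2) _ zero] by blast
  qed
qed

section \<open>Nilpotent lcs Lie algebras\<close>

lemma ce_diff_2: "ce_diff br \<alpha> [x, y] = - \<alpha> [br x y]"
  by (simp add: ce_diff_def numeral_2_eq_2 nths_Cons)

lemma ce_diff_3:
  "ce_diff br \<alpha> [x, y, z] = - \<alpha> [br x y, z] + \<alpha> [br x z, y] - \<alpha> [br y z, x]"
  by (simp add: ce_diff_def numeral_3_eq_3 nths_Cons)

text \<open>No symmetry of \<open>\<beta>\<close> is assumed, hence the differences; for alternating
  \<open>\<beta>\<close> each of them doubles and cancels the 2.\<close>

lemma wedge_1_2:
  "wedge 1 2 \<alpha> \<beta> [x, y, z] = (\<alpha> [x] * (\<beta> [y, z] - \<beta> [z, y]) - \<alpha> [y] * (\<beta> [x, z] - \<beta> [z, x])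
    + \<alpha> [z] * (\<beta> [x, y] - \<beta> [y, x])) / 2"
proof -
  \<comment> \<open>The permutations of three indices are enumerated by inserting 1 and then 0 into
    the singleton of 2.\<close>
  have 3: "{..<1 + 2} = {0, 1, 2 :: nat}" by auto
  have f: "finite {1, 2 :: nat}" "0 \<notin> {1, 2 :: nat}" "finite {2 :: nat}" "1 \<notin> {2 :: nat}" by auto
  have upt: "[0..<1] = [0]" "[1..<1 + 2] = [1, 2]" by (simp_all add: upt_rec)
  show ?thesis
    unfolding wedge_def 3 upt
    unfolding sum_over_permutations_insert[OF f(1,2)]
    unfolding sum_over_permutations_insert[OF f(3,4)]
    unfolding permutes_sing
    by (simp add: sign_swap_id permutation_swap_id sign_compose transpose_def algebra_simps
        divide_simps)
qed

section \<open>Center and lower central series\<close>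

context lie_algebra
begin

lemma zero_mem: "0 \<in> \<gg>"
  using subspace by (rule subspace_0)

lemma br_zero_left: "y \<in> \<gg> \<Longrightarrow> br 0 y = 0"
  using br_scale_left[of 0 y 0] zero_mem by simp

lemma br_swap:
  assumes "x \<in> \<gg>" "y \<in> \<gg>"
  shows "br x y = - br y x"
proof -
  have "br (x + y) (x + y) = br x y + br y x"
    using assms br_self[OF assms(1)] br_self[OF assms(2)]
    by (simp add: br_add_left br_add_right subspace_add[OF subspace])
  then show ?thesis
    by (simp add: br_self subspace_add[OF subspace assms] eq_neg_iff_add_eq_0)
qed

lemma br_mem_lower_central:
  "x \<in> \<gg> \<Longrightarrow> y \<in> lower_central \<gg> br k \<Longrightarrow> br x y \<in> lower_central \<gg> br (Suc k)"
  by (auto intro: span_base)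

lemma subspace_lie_center: "subspace (lie_center \<gg> br)"
  using subspace unfolding lie_center_def subspace_def
  by (auto simp: br_zero_left br_add_left br_scale_left)

text \<open>Otherwise every nonzero element of \<open>I\<close> has a nonzero bracket with
  something. That bracket is again in \<open>I\<close> and one step deeper in the lower central
  series, which then never reaches zero.\<close>

lemma nilpotent_ideal_meets_center:
  assumes nil: "lie_nilpotent \<gg> br" and I: "I \<subseteq> \<gg>" "\<And>x y. x \<in> \<gg> \<Longrightarrow> y \<in> I \<Longrightarrow> br x y \<in> I"
    and v: "v \<in> I" "v \<noteq> 0"
  shows "\<exists>y\<in>I \<inter> lie_center \<gg> br. y \<noteq> 0"
proof (rule ccontr)
  assume not: "\<not> ?thesis"
  have "\<exists>y\<in>I \<inter> lower_central \<gg> br k. y \<noteq> 0" for k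
  proof (induction k)
    case 0
    then show ?case using v I by auto
  next
    case (Suc k)
    then obtain y where y: "y \<in> I" "y \<in> lower_central \<gg> br k" "y \<noteq> 0" by auto
    have yg: "y \<in> \<gg>" using y(1) I(1) by blast
    have "y \<notin> lie_center \<gg> br" using not y by blast
    then obtain z where z: "z \<in> \<gg>" "br y z \<noteq> 0"
      using yg by (auto simp: lie_center_def)
    then have "br z y \<noteq> 0" using br_swap[OF yg z(1)] by simp
    then show ?case using I(2)[OF z(1) y(1)] br_mem_lower_central[OF z(1) y(2)] by blast
  qed
  then show False using nil unfolding lie_nilpotent_def by (metis Int_iff singletonD)
qed

end

section \<open>The forms of an lcs Lie algebra\<close>

context lcs_lie_algebra
begin

abbreviation theta_kernel :: "'a set" where
  "theta_kernel \<equiv> {x \<in> \<gg>. \<theta> [x] = 0}"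

lemma theta_add: "x \<in> \<gg> \<Longrightarrow> y \<in> \<gg> \<Longrightarrow> \<theta> [x + y] = \<theta> [x] + \<theta> [y]"
  using multilinear_form_add[OF alt_form_multilinear[OF theta_form], of "[x]" 0 x y] by simp

lemma theta_scale: "x \<in> \<gg> \<Longrightarrow> \<theta> [c *\<^sub>R x] = c * \<theta> [x]"
  using multilinear_form_scale[OF alt_form_multilinear[OF theta_form], of "[x]" 0 x c] by simp

lemma theta_diff: "x \<in> \<gg> \<Longrightarrow> y \<in> \<gg> \<Longrightarrow> \<theta> [x - y] = \<theta> [x] - \<theta> [y]"
  using theta_add[of "x - y" y] subspace_diff[OF subspace, of x y] by simp

lemma theta_zero: "\<theta> [0] = 0"
  using theta_scale[of 0 0] zero_mem by simp

lemma Omega_add_left: "x \<in> \<gg> \<Longrightarrow> y \<in> \<gg> \<Longrightarrow> z \<in> \<gg> \<Longrightarrow> \<Omega> [x + y, z] = \<Omega> [x, z] + \<Omega> [y, z]"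
  using multilinear_form_add[OF alt_form_multilinear[OF Omega_form], of "[z, z]" 0 x y] by simp

lemma Omega_scale_left: "x \<in> \<gg> \<Longrightarrow> y \<in> \<gg> \<Longrightarrow> \<Omega> [c *\<^sub>R x, y] = c * \<Omega> [x, y]"
  using multilinear_form_scale[OF alt_form_multilinear[OF Omega_form], of "[y, y]" 0 x c] by simp

lemma Omega_add_right: "x \<in> \<gg> \<Longrightarrow> y \<in> \<gg> \<Longrightarrow> z \<in> \<gg> \<Longrightarrow> \<Omega> [z, x + y] = \<Omega> [z, x] + \<Omega> [z, y]"
  using multilinear_form_add[OF alt_form_multilinear[OF Omega_form], of "[z, z]" 1 x y] by simp

lemma Omega_scale_right: "x \<in> \<gg> \<Longrightarrow> y \<in> \<gg> \<Longrightarrow> \<Omega> [y, c *\<^sub>R x] = c * \<Omega> [y, x]"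
  using multilinear_form_scale[OF alt_form_multilinear[OF Omega_form], of "[y, y]" 1 x c] by simp

lemma Omega_diff_left:
  "x \<in> \<gg> \<Longrightarrow> y \<in> \<gg> \<Longrightarrow> z \<in> \<gg> \<Longrightarrow> \<Omega> [x - y, z] = \<Omega> [x, z] - \<Omega> [y, z]"
  using Omega_add_left[of "x - y" y z] subspace_diff[OF subspace, of x y] by simp

lemma Omega_zero_left: "y \<in> \<gg> \<Longrightarrow> \<Omega> [0, y] = 0"
  using Omega_scale_left[of 0 y 0] zero_mem by simp

lemma Omega_zero_right: "y \<in> \<gg> \<Longrightarrow> \<Omega> [y, 0] = 0"
  using Omega_scale_right[of 0 y 0] zero_mem by simp

lemma Omega_self: "x \<in> \<gg> \<Longrightarrow> \<Omega> [x, x] = 0"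
  using alt_form_repeated[OF Omega_form, of "[x, x]" 0 1] by simp

lemma Omega_swap: "x \<in> \<gg> \<Longrightarrow> y \<in> \<gg> \<Longrightarrow> \<Omega> [x, y] = - \<Omega> [y, x]"
  using alt_form_2_swap[OF Omega_form subspace] .

text \<open>This is closedness of \<open>\<theta>\<close>; it makes the kernel of
  \<open>\<theta>\<close> an ideal.\<close>

lemma theta_br: "x \<in> \<gg> \<Longrightarrow> y \<in> \<gg> \<Longrightarrow> \<theta> [br x y] = 0"
  using theta_closed[unfolded form_eq_def, rule_format, of "[x, y]"]
  by (simp add: ce_diff_2 zero_form_def)

lemma d_Omega_eq:
  assumes "x \<in> \<gg>" "y \<in> \<gg>" "z \<in> \<gg>"
  shows "- \<Omega> [br x y, z] + \<Omega> [br x z, y] - \<Omega> [br y z, x] =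
    \<theta> [x] * \<Omega> [y, z] - \<theta> [y] * \<Omega> [x, z] + \<theta> [z] * \<Omega> [x, y]"
proof -
  have "ce_diff br \<Omega> [x, y, z] = wedge 1 2 \<theta> \<Omega> [x, y, z]"
    using d_Omega assms by (simp add: form_eq_def)
  then show ?thesis
    unfolding ce_diff_3 wedge_1_2
    using assms Omega_swap[of z y] Omega_swap[of z x] Omega_swap[of y x] by simp
qed

text \<open>Brackets with \<open>x\<close> drop out of the differential. It serves twice: with
  \<open>\<theta> [x] = 0\<close> to locate the center, and with \<open>\<theta> [x] = 1\<close> to
  compute the differential of the contact form.\<close>

lemma d_Omega_eq_center:
  assumes "x \<in> lie_center \<gg> br" "y \<in> \<gg>" "z \<in> \<gg>"
  shows "\<Omega> [x, br y z] = \<theta> [x] * \<Omega> [y, z] - \<theta> [y] * \<Omega> [x, z] + \<theta> [z] * \<Omega> [x, y]"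
proof -
  have x: "x \<in> \<gg>" "br x y = 0" "br x z = 0" using assms by (auto simp: lie_center_def)
  then show ?thesis
    using d_Omega_eq[of x y z] Omega_swap[of x "br y z"] assms(2,3)
    by (simp add: br_closed Omega_zero_left)
qed

lemma Omega_nondegenerate:
  assumes "x \<in> \<gg>" "\<And>y. y \<in> \<gg> \<Longrightarrow> \<Omega> [x, y] = 0"
  shows "x = 0"
proof (rule ccontr)
  assume "x \<noteq> 0"
  moreover have "n > 0" using dim_ge by simp
  ultimately show False
    using form_eq_wedge_power2_zero_if_degenerate[OF Omega_form subspace dim_eq _ assms(1) _ assms(2)]
      nondegenerate by blast
qed

lemma subspace_theta_kernel: "subspace theta_kernel"
  by (rule subspaceI)
     (use subspace in \<open>simp_all add: zero_mem theta_zero subspace_add theta_add subspace_scale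
       theta_scale\<close>)

lemma center_theta_kernel_subset:
  assumes nil: "lie_nilpotent \<gg> br" and U: "U \<in> \<gg>" "\<theta> [U] = 1"
    and V: "characteristic_vector \<gg> \<Omega> \<theta> V"
    and x: "x \<in> lie_center \<gg> br" "\<theta> [x] = 0"
  shows "\<exists>c. x = c *\<^sub>R V"
proof -
  have V_mem: "V \<in> \<gg>" and V_eq: "\<And>y. y \<in> \<gg> \<Longrightarrow> \<Omega> [V, y] = \<theta> [y]"
    using V by (auto simp: characteristic_vector_def form_eq_def interior_product_def)
  have xg: "x \<in> \<gg>" using x by (simp add: lie_center_def)
  have ker: "\<Omega> [x, z] = 0" if z: "z \<in> theta_kernel" for z
  proof -
    \<comment> \<open>Iterates of \<open>br U\<close> descend the lower central series, so one of
      them is zero, while pairing with \<open>x\<close> only changes sign.\<close>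
    have iterate: "((br U) ^^ k) z \<in> lower_central \<gg> br k \<inter> theta_kernel \<and>
        \<Omega> [x, ((br U) ^^ k) z] = (-1) ^ k * \<Omega> [x, z]" for k
    proof (induction k)
      case (Suc k)
      let ?w = "((br U) ^^ k) z"
      have "\<Omega> [x, br U ?w] = - \<Omega> [x, ?w]"
        using d_Omega_eq_center[OF x(1) U(1), of ?w] Suc U x by simp
      moreover have "br U ?w \<in> lower_central \<gg> br (Suc k)"
        using Suc U br_mem_lower_central by blast
      ultimately show ?case
        using Suc U by (auto simp: br_closed theta_br simp del: lower_central.simps)
    qed (use z in auto)
    obtain k where "lower_central \<gg> br k = {0}"
      using nil unfolding lie_nilpotent_def by blast
    with iterate[of k] have "((br U) ^^ k) z = 0" by blast
    with iterate[of k] show ?thesis using Omega_zero_right[OF xg] by simp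
  qed
  \<comment> \<open>The coefficient comes from pairing \<open>x = c *\<^sub>R V\<close> with
    \<open>U\<close>, as \<open>\<Omega> [V, U] = \<theta> [U] = 1\<close>. The difference is shown
    to lie in the radical of \<open>\<Omega>\<close>.\<close>
  have "x - \<Omega> [x, U] *\<^sub>R V = 0"
  proof (rule Omega_nondegenerate)
    show "x - \<Omega> [x, U] *\<^sub>R V \<in> \<gg>"
      using xg V_mem U subspace by (simp add: subspace_diff subspace_scale)
    fix y assume y: "y \<in> \<gg>"
    have tU: "\<theta> [y] *\<^sub>R U \<in> \<gg>" using U subspace by (simp add: subspace_scale)
    have "y - \<theta> [y] *\<^sub>R U \<in> theta_kernel"
      using y U tU subspace by (simp add: subspace_diff theta_diff theta_scale)
    then have "\<Omega> [x, y] = \<Omega> [x, \<theta> [y] *\<^sub>R U]"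
      using ker[of "y - \<theta> [y] *\<^sub>R U"] Omega_add_right[of "y - \<theta> [y] *\<^sub>R U" "\<theta> [y] *\<^sub>R U" x] xg tU
      by simp
    then show "\<Omega> [x - \<Omega> [x, U] *\<^sub>R V, y] = 0"
      using xg V_mem U y subspace
      by (simp add: Omega_diff_left Omega_scale_left Omega_scale_right subspace_scale V_eq)
  qed
  then show ?thesis by auto
qed

text \<open>In the Lie derivative the brackets with \<open>U\<close> vanish, and the remaining terms
  \<open>- \<Omega> [br y z, U]\<close> and \<open>- \<Omega> [U, br y z]\<close> cancel.\<close>

lemma central_transversal_vector:
  assumes "U \<in> lie_center \<gg> br" "\<theta> [U] = 1"
  shows "transversal_vector \<gg> br \<Omega> \<theta> U"
proof -
  have U: "U \<in> \<gg>" "\<And>y. y \<in> \<gg> \<Longrightarrow> br U y = 0" using assms by (auto simp: lie_center_def)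
  have "lie_derivative br U \<Omega> [y, z] = 0" if "y \<in> \<gg>" "z \<in> \<gg>" for y z
    unfolding lie_derivative_def interior_product_def ce_diff_2 ce_diff_3
    using that U Omega_swap[of U "br y z"] by (simp add: br_closed Omega_zero_left)
  then have "form_eq \<gg> 2 (lie_derivative br U \<Omega>) zero_form"
    by (auto simp: form_eq_def zero_form_def numeral_2_eq_2 length_Suc_conv)
  then show ?thesis using U assms by (simp add: transversal_vector_def lcs_automorphisms_def)
qed

section \<open>The kernel of \<open>\<theta>\<close> as contact summand\<close>

lemma theta_kernel_basis:
  assumes U: "U \<in> \<gg>" "\<theta> [U] \<noteq> 0"
  obtains B where "finite B" "independent B" "span B = theta_kernel" "card (insert U B) = 2 * n"
    "U \<notin> B" "\<gg> \<subseteq> span (insert U B)"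
proof -
  obtain B where B: "B \<subseteq> theta_kernel" "independent B" "theta_kernel \<subseteq> span B"
    using maximal_independent_subset_extend[of "{}" theta_kernel] by (auto simp: independent_empty)
  then have span: "span B = theta_kernel"
    by (intro span_subspace subspace_theta_kernel)
  then have "U \<notin> span B" using U by simp
  then have ind: "independent (insert U B)" "U \<notin> B"
    using independent_insertI[OF _ B(2)] span_base[of U B] by blast+
  have sp: "\<gg> \<subseteq> span (insert U B)"
  proof
    fix y assume y: "y \<in> \<gg>"
    then have "y - (\<theta> [y] / \<theta> [U]) *\<^sub>R U \<in> span B"
      using U subspace unfolding span
      by (simp add: subspace_diff subspace_scale theta_diff theta_scale)
    then show "y \<in> span (insert U B)" unfolding span_breakdown_eq by blast
  qed
  have "insert U B \<subseteq> \<gg>" using B U by auto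
  from basis_card_eq_dim[OF this sp ind(1)] have card: "card (insert U B) = 2 * n"
    by (simp add: dim_eq)
  then have "finite B" using dim_ge by (metis card.infinite finite_insert not_numeral_le_zero)
  with B span card ind sp show ?thesis using that by blast
qed

lemma lie_algebra_theta_kernel:
  assumes "U \<in> \<gg>" "\<theta> [U] \<noteq> 0"
  shows "lie_algebra theta_kernel br"
proof -
  obtain B where "finite B" "span B = theta_kernel" using theta_kernel_basis[OF assms] .
  then show ?thesis
    by unfold_locales
       (auto simp: subspace_theta_kernel br_closed theta_br br_self br_add_left br_add_right
          br_scale_left br_scale_right intro: jacobi)
qed

lemma contact_theta_kernel:
  assumes U: "U \<in> lie_center \<gg> br" "\<theta> [U] = 1"
  shows "contact_lie_algebra theta_kernel br n (interior_product (- U) \<Omega>)"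
proof -
  have Ug: "U \<in> \<gg>" using U by (simp add: lie_center_def)
  \<comment> \<open>The sign compensates the one in \<open>ce_diff_2\<close>, so that the
    differential of the contraction is \<open>\<Omega>\<close> and not its negative.\<close>
  let ?x = "- U"
  have x: "?x \<in> \<gg>" using Ug subspace by (simp add: subspace_neg)
  have tx: "\<theta> [?x] = - 1" using theta_scale[OF Ug, of "-1"] U by simp
  interpret h: lie_algebra theta_kernel br using lie_algebra_theta_kernel[OF Ug] U by simp
  obtain B where B: "finite B" "independent B" "span B = theta_kernel" "card (insert ?x B) = 2 * n"
    "?x \<notin> B" "\<gg> \<subseteq> span (insert ?x B)"
    using theta_kernel_basis[OF x] tx by auto
  have Bk: "B \<subseteq> theta_kernel" using B(3) span_superset by blast
  obtain k where k: "n = Suc k" using dim_ge by (cases n) auto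
  have d_eta: "form_eq theta_kernel 2 (ce_diff br (interior_product ?x \<Omega>)) \<Omega>"
  proof -
    have "- \<Omega> [?x, br y z] = \<Omega> [y, z]" if "y \<in> theta_kernel" "z \<in> theta_kernel" for y z
      using d_Omega_eq_center[OF U(1), of y z] that U Omega_scale_left[OF Ug, of "br y z" "-1"]
      by (simp add: br_closed)
    then show ?thesis
      by (auto simp: form_eq_def numeral_2_eq_2 length_Suc_conv ce_diff_2 interior_product_def)
  qed
  show ?thesis
  proof
    show "dim theta_kernel + 1 = 2 * n"
      using B dim_span_eq_card_independent[of B] by simp
    show "alt_form theta_kernel 1 (interior_product ?x \<Omega>)"
      using Omega_form x
      by (intro alt_form_subset[OF alt_form_interior_product]) (auto simp: numeral_2_eq_2)
    show "\<not> form_eq theta_kernel (2 * n - 1) (wedge 1 (2 * (n - 1)) (interior_product ?x \<Omega>)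
        (wedge_power 2 (ce_diff br (interior_product ?x \<Omega>)) (n - 1))) zero_form"
    proof
      assume zero: "form_eq theta_kernel (2 * n - 1) (wedge 1 (2 * (n - 1)) (interior_product ?x \<Omega>)
        (wedge_power 2 (ce_diff br (interior_product ?x \<Omega>)) (n - 1))) zero_form"
      have "form_eq theta_kernel (1 + k * 2) (wedge 1 (k * 2) (interior_product ?x \<Omega>)
          (wedge_power 2 (ce_diff br (interior_product ?x \<Omega>)) k))
          (wedge 1 (k * 2) (interior_product ?x \<Omega>) (wedge_power 2 \<Omega> k))"
        by (intro wedge_cong wedge_power_cong d_eta) (simp add: form_eq_def)
      with zero have *: "wedge 1 (k * 2) (interior_product ?x \<Omega>) (wedge_power 2 \<Omega> k) ys = 0"
        if "length ys = Suc (k * 2)" "set ys \<subseteq> theta_kernel" for ys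
        using that by (simp add: form_eq_def zero_form_def k mult.commute)
      \<comment> \<open>By the contraction formula this value is \<open>Suc k\<close> times a value
        of the contact volume form, which is zero by \<open>*\<close>.\<close>
      have "wedge_power 2 \<Omega> (Suc k) (?x # ys) = 0"
        if "Suc (length ys) = Suc k * 2" "set ys \<subseteq> B" for ys
      proof -
        have "length ys = Suc (k * 2)" "set ys \<subseteq> theta_kernel" "set ys \<subseteq> \<gg>"
          using that Bk by auto
        with * interior_product_wedge_power2[OF Omega_form subspace x, of ys k]
        have "interior_product ?x (wedge_power 2 \<Omega> (Suc k)) ys = 0" by (simp only: mult_zero_right)
        then show ?thesis by (simp only: interior_product_def)
      qed
      then have "form_eq \<gg> (n * 2) (wedge_power 2 \<Omega> n) zero_form"
        using B Bk x unfolding k[symmetric]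
        by (intro form_eq_wedge_power2_zero_if_zero_on_insert[OF Omega_form subspace, of ?x B])
           (simp_all add: subset_iff mult.commute)
      then show False using nondegenerate by (simp add: mult.commute)
    qed
  qed
qed

text \<open>Split off the \<open>U\<close>-component, whose coefficient is \<open>\<theta>\<close>.
  Centrality of \<open>U\<close> makes brackets depend only on the kernel components, and
  \<open>\<theta>\<close> vanishes on brackets, so the real summand is abelian.\<close>

lemma lie_isomorphic_theta_kernel_times_real:
  assumes "U \<in> lie_center \<gg> br" "\<theta> [U] = 1"
  shows "lie_isomorphic \<gg> br (theta_kernel \<times> (UNIV :: real set)) (sum_bracket br (\<lambda>_ _. 0))"
proof -
  have U: "U \<in> \<gg>" "\<And>y. y \<in> \<gg> \<Longrightarrow> br U y = 0" "\<And>y. y \<in> \<gg> \<Longrightarrow> br y U = 0"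
    using assms br_swap[of _ U] by (auto simp: lie_center_def)
  have cU: "c *\<^sub>R U \<in> \<gg>" for c using U subspace by (simp add: subspace_scale)
  define f where "f y = (y - \<theta> [y] *\<^sub>R U, \<theta> [y])" for y
  have "bij_betw f \<gg> (theta_kernel \<times> UNIV)"
  proof (rule bij_betwI[where g = "\<lambda>(a, c). a + c *\<^sub>R U"])
    show "f \<in> \<gg> \<rightarrow> theta_kernel \<times> UNIV"
      using subspace U assms cU by (auto simp: f_def subspace_diff theta_diff theta_scale)
    show "(\<lambda>(a, c). a + c *\<^sub>R U) \<in> theta_kernel \<times> UNIV \<rightarrow> \<gg>"
      using subspace cU by (auto simp: subspace_add)
    show "f (case y of (a, c) \<Rightarrow> a + c *\<^sub>R U) = y" if "y \<in> theta_kernel \<times> UNIV" for y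
      using that U assms cU by (auto simp: f_def theta_add theta_scale)
  qed (simp add: f_def)
  moreover have "br (x - a *\<^sub>R U) (y - b *\<^sub>R U) = br x y" if "x \<in> \<gg>" "y \<in> \<gg>" for x y a b
  proof -
    have "br (x + (- a) *\<^sub>R U) (y + (- b) *\<^sub>R U) = br x y"
      using that U cU subspace
      by (simp add: br_add_left br_add_right br_scale_left br_scale_right subspace_add
          del: scaleR_minus_left)
    then show ?thesis by simp
  qed
  then have "f (br x y) = sum_bracket br (\<lambda>_ _. 0) (f x) (f y)" if "x \<in> \<gg>" "y \<in> \<gg>" for x y
    using that by (simp add: f_def sum_bracket_def theta_br)
  ultimately show ?thesis
    unfolding lie_isomorphic_def
    by (intro exI[of _ f])
       (auto simp: f_def theta_add theta_scale algebra_simps scaleR_add_left)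
qed

end

theorem corollary2p6:
  fixes \<gg> :: "'a::real_vector set" and br :: "'a \<Rightarrow> 'a \<Rightarrow> 'a"
    and n :: nat and \<Omega> \<theta> :: "'a list \<Rightarrow> real" and V :: 'a
  assumes "lcs_lie_algebra \<gg> br n \<Omega> \<theta>"
    and "lie_nilpotent \<gg> br"
    and "\<not> form_eq \<gg> 1 \<theta> zero_form"
    and "characteristic_vector \<gg> \<Omega> \<theta> V"
  shows "lie_center \<gg> br = span {V} \<or>
    (\<exists>U. transversal_vector \<gg> br \<Omega> \<theta> U \<and> lie_center \<gg> br = span {U, V}) \<and>
    (\<exists>(\<hh> :: 'a set) br\<^sub>\<hh> m \<eta>. contact_lie_algebra \<hh> br\<^sub>\<hh> m \<eta> \<and>
      lie_isomorphic \<gg> br (\<hh> \<times> (UNIV :: real set)) (sum_bracket br\<^sub>\<hh> (\<lambda>_ _. 0)))"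
proof -
  interpret lcs_lie_algebra \<gg> br n \<Omega> \<theta> by (rule assms(1))
  let ?Z = "lie_center \<gg> br"
  obtain W where W: "W \<in> \<gg>" "\<theta> [W] \<noteq> 0"
    using assms(3) by (auto simp: form_eq_def zero_form_def length_Suc_conv)
  have "\<exists>U\<in>\<gg>. \<theta> [U] = 1"
    using W subspace
    by (intro bexI[of _ "(1 / \<theta> [W]) *\<^sub>R W"]) (simp_all add: theta_scale subspace_scale)
  then have Z_kernel: "\<exists>c. x = c *\<^sub>R V" if "x \<in> ?Z" "\<theta> [x] = 0" for x
    using center_theta_kernel_subset[OF assms(2) _ _ assms(4) that] by blast
  have V: "V \<in> \<gg>" "\<And>y. y \<in> \<gg> \<Longrightarrow> \<Omega> [V, y] = \<theta> [y]"
    using assms(4) by (auto simp: characteristic_vector_def form_eq_def interior_product_def)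
  have "V \<noteq> 0" using V(2)[OF W(1)] W Omega_zero_left by auto
  \<comment> \<open>Indeed \<open>\<theta> [V] = \<Omega> [V, V] = 0\<close>.\<close>
  have "V \<in> theta_kernel" using V Omega_self[of V] by auto
  then obtain y where y: "y \<in> theta_kernel" "y \<in> ?Z" "y \<noteq> 0"
    using nilpotent_ideal_meets_center[OF assms(2), of theta_kernel V] \<open>V \<noteq> 0\<close>
    by (auto simp: br_closed theta_br)
  then obtain c where "y = c *\<^sub>R V" using Z_kernel by blast
  \<comment> \<open>Here \<open>c\<close> is nonzero because \<open>y\<close> is, so centrality
    passes from \<open>y\<close> to \<open>V\<close>.\<close>
  then have "V = (1 / c) *\<^sub>R y" using y by auto
  then have VZ: "V \<in> ?Z" using y subspace_scale[OF subspace_lie_center] by blast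
  show ?thesis
  \<comment> \<open>The alternative is whether \<open>\<theta>\<close> vanishes on the center; if
    not, a central vector can be rescaled to a transversal one.\<close>
  proof (cases "\<exists>x\<in>?Z. \<theta> [x] \<noteq> 0")
    case False
    then have "?Z \<subseteq> span {V}" using Z_kernel by (force simp: span_singleton)
    then show ?thesis
      using span_minimal[of "{V}", OF _ subspace_lie_center] VZ by auto
  next
    case True
    then obtain x where x: "x \<in> ?Z" "\<theta> [x] \<noteq> 0" by blast
    define U where "U = (1 / \<theta> [x]) *\<^sub>R x"
    have "x \<in> \<gg>" using x by (simp add: lie_center_def)
    then have U: "U \<in> ?Z" "\<theta> [U] = 1"
      using x subspace_scale[OF subspace_lie_center] by (auto simp: U_def theta_scale)
    then have "U \<in> \<gg>" by (simp add: lie_center_def)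
    have "?Z \<subseteq> span {U, V}"
    proof
      fix z assume z: "z \<in> ?Z"
      then have "z \<in> \<gg>" by (simp add: lie_center_def)
      have tU: "\<theta> [z] *\<^sub>R U \<in> ?Z" using U subspace_scale[OF subspace_lie_center] by blast
      then have "z - \<theta> [z] *\<^sub>R U \<in> ?Z" using z subspace_diff[OF subspace_lie_center] by blast
      moreover have "\<theta> [z - \<theta> [z] *\<^sub>R U] = 0"
        using \<open>z \<in> \<gg>\<close> \<open>U \<in> \<gg>\<close> U tU by (simp add: theta_diff theta_scale lie_center_def)
      ultimately obtain c where "z - \<theta> [z] *\<^sub>R U = c *\<^sub>R V" using Z_kernel by blast
      then show "z \<in> span {U, V}" unfolding span_breakdown_eq[of z] span_singleton by auto
    qed
    then have "?Z = span {U, V}"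
      using span_minimal[of "{U, V}", OF _ subspace_lie_center] VZ U by auto
    then show ?thesis
      using central_transversal_vector[OF U] contact_theta_kernel[OF U]
        lie_isomorphic_theta_kernel_times_real[OF U] by blast
  qed
qed

end
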